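(* (1) There exist $\Pi^0_1$ sets $P,Q\subseteq 2^{\mathbb N}$ such that $P\equiv^{<\omega}_1Q$ holds but $Q\not\le^1_\omega P$. (2) There exist $\Pi^0_1$ sets $P,Q\subseteq 2^{\mathbb N}$ such that $P\equiv^{<\omega}_\omega Q$ holds but $P<^1_\omega Q$.
   Context: Let $\{\Phi_e\}_{e\in\mathbb N}$ be an effective enumeration of all partial computable functions $\Phi_e:\subseteq\mathbb N^{\mathbb N}\to\mathbb N^{\mathbb N}$. A learner is a total computable function $\Psi:\mathbb N^{<\mathbb N}\to\mathbb N$; let $\{\Psi_e\}_{e\in\mathbb N}$ be an effective enumeration of all learners. A partial function $\Gamma:\subseteq\mathbb N^{\mathbb N}\to\mathbb N^{\mathbb N}$ is identified by $\Psi$ on $g$ if $\lim_n\Psi(g\upharpoonright n)$ exists and $\Phi_{\lim_n\Psi(g\upharpoonright n)}(g)=\Gamma(g)$. $\Gamma$ is $(1,\omega)$-computable if some single learner identifies it on every $g\in\mathrm{dom}(\Gamma)$. $\Gamma$ is $(<\omega,1)$-computable if there is $b\in\mathbb N$ such that for every $g\in\mathrm{dom}(\Gamma)$, $\Gamma(g)=\Phi_e(g)$ for some $e<b$. $\Gamma$ is $(<\omega,\omega)$-computable if there is $b\in\mathbb N$ such that for every $g\in\mathrm{dom}(\Gamma)$, $\Gamma$ is identified by $\Psi_e$ on $g$ for some $e<b$. For $A,B\subseteq\mathbb N^{\mathbb N}$, $A\le^\alpha_\beta B$ means there is an $(\alpha,\beta)$-computable partial function $\Gamma$ with $B\subseteq\mathrm{dom}(\Gamma)$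 and $\Gamma(g)\in A$ for every $g\in B$. $A\equiv^\alpha_\beta B$ means $A\le^\alpha_\beta B$ and $B\le^\alpha_\beta A$; $A<^\alpha_\beta B$ means $A\le^\alpha_\beta B$ and $B\not\le^\alpha_\beta A$. *)

theory Defs
  imports Complex_Main "HOL-Library.Nat_Bijection"
begin

(* Programs for unary partial recursive functions on the natural numbers relative to an
   oracle; several arguments are passed through the pairing function prod_encode. *)
datatype prog =
    Zero
  | Succ
  | First
  | Second
  | Oracle
  | Paired prog prog
  | Comp prog prog
  | PrimRec prog prog
  | Mu prog

(* With <x,y> for prod_encode (x, y):
   PrimRec p q computes h with h<x,0> = p(x) and h<x,k+1> = q<x,<k,h<x,k>>>;
   Mu p computes the least k with p<x,k> = 0, provided p<x,j> is defined for all j < k. *)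
primrec eval :: "(nat \<Rightarrow> nat) \<Rightarrow> prog \<Rightarrow> nat \<Rightarrow> nat option" where
  "eval g Zero = (\<lambda>x. Some 0)"
| "eval g Succ = (\<lambda>x. Some (Suc x))"
| "eval g First = (\<lambda>x. Some (fst (prod_decode x)))"
| "eval g Second = (\<lambda>x. Some (snd (prod_decode x)))"
| "eval g Oracle = (\<lambda>x. Some (g x))"
| "eval g (Paired p q) =
     (\<lambda>x. Option.bind (eval g p x) (\<lambda>u. Option.bind (eval g q x) (\<lambda>v. Some (prod_encode (u, v)))))"
| "eval g (Comp p q) = (\<lambda>x. Option.bind (eval g q x) (eval g p))"
| "eval g (PrimRec p q) =
     (\<lambda>z. case prod_decode z of (x, k) \<Rightarrow>
        rec_nat (eval g p x)
          (\<lambda>i r. Option.bind r (\<lambda>v. eval g q (prod_encode (x, prod_encode (i, v))))) k)"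
| "eval g (Mu p) =
     (\<lambda>x. let halts = (\<lambda>k. eval g p (prod_encode (x, k)) = Some 0 \<and>
                           (\<forall>j<k. eval g p (prod_encode (x, j)) \<noteq> None))
          in if \<exists>k. halts k then Some (LEAST k. halts k) else None)"

(* Goedel numbering: 0,...,4 are the basic programs; 5 + 4 * m + r codes the compound program
   of kind r whose components are given by m. *)
function prog_of :: "nat \<Rightarrow> prog" where
  "prog_of e =
     (if e = 0 then Zero else if e = 1 then Succ else if e = 2 then First
      else if e = 3 then Second else if e = 4 then Oracle
      else let m = (e - 5) div 4; r = (e - 5) mod 4;
               a = fst (prod_decode m); b = snd (prod_decode m)
           in if r = 0 then Paired (prog_of a) (prog_of b)
              else if r = 1 then Comp (prog_of a) (prog_of b)
              else if r = 2 then PrimRec (prog_of a) (prog_of b)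
              else Mu (prog_of m))"
  by pat_completeness auto

lemma prod_decode_div_less:
  fixes e :: nat
  assumes "e \<noteq> 0"
  shows "fst (prod_decode ((e - 5) div 4)) < e" "snd (prod_decode ((e - 5) div 4)) < e"
proof -
  have "(e - 5) div 4 < e"
    using assms by linarith
  moreover have "fst (prod_decode m) \<le> m" "snd (prod_decode m) \<le> m" for m
    by (metis le_prod_encode_1 le_prod_encode_2 prod.collapse prod_decode_inverse)+
  ultimately show "fst (prod_decode ((e - 5) div 4)) < e" "snd (prod_decode ((e - 5) div 4)) < e"
    using le_less_trans by blast+
qed

termination prog_of
proof (relation "measure id", goal_cases)
  case 1
  show ?case by simp
qed (auto intro: prod_decode_div_less)

declare prog_of.simps [simp del]

lemma surj_prog_of: "surj prog_of"
proof -
  have "\<exists>e. prog_of e = p" for p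
  proof (induction p)
    case Zero
    show ?case by (rule exI[of _ 0]) (simp add: prog_of.simps)
  next
    case Succ
    show ?case by (rule exI[of _ 1]) (simp add: prog_of.simps)
  next
    case First
    show ?case by (rule exI[of _ 2]) (simp add: prog_of.simps)
  next
    case Second
    show ?case by (rule exI[of _ 3]) (simp add: prog_of.simps)
  next
    case Oracle
    show ?case by (rule exI[of _ 4]) (simp add: prog_of.simps)
  next
    case (Paired p q)
    then obtain a b where "prog_of a = p" "prog_of b = q" by blast
    then show ?case
      by (intro exI[of _ "5 + 4 * prod_encode (a, b)"]) (subst prog_of.simps, simp)
  next
    case (Comp p q)
    then obtain a b where "prog_of a = p" "prog_of b = q" by blast
    moreover have "(4 * m + 1) div 4 = m" "(4 * m + 1) mod 4 = 1" for m :: nat by presburger+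
    ultimately show ?case
      by (intro exI[of _ "5 + (4 * prod_encode (a, b) + 1)"]) (subst prog_of.simps, simp)
  next
    case (PrimRec p q)
    then obtain a b where "prog_of a = p" "prog_of b = q" by blast
    moreover have "(4 * m + 2) div 4 = m" "(4 * m + 2) mod 4 = 2" for m :: nat by presburger+
    ultimately show ?case
      by (intro exI[of _ "5 + (4 * prod_encode (a, b) + 2)"]) (subst prog_of.simps, simp)
  next
    case (Mu p)
    then obtain a where "prog_of a = p" by blast
    moreover have "(4 * m + 3) div 4 = m" "(4 * m + 3) mod 4 = 3" for m :: nat by presburger+
    ultimately show ?case
      by (intro exI[of _ "5 + (4 * a + 3)"]) (subst prog_of.simps, simp)
  qed
  then show ?thesis by (metis surjI)
qed

type_synonym pfun = "(nat \<Rightarrow> nat) \<rightharpoonup> (nat \<Rightarrow> nat)"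

definition Phi :: "nat \<Rightarrow> pfun" where
  "Phi e g = (if \<forall>n. eval g (prog_of e) n \<noteq> None
              then Some (\<lambda>n. the (eval g (prog_of e) n)) else None)"

definition initseg :: "(nat \<Rightarrow> nat) \<Rightarrow> nat \<Rightarrow> nat list" where
  "initseg g n = map g [0..<n]"

(* Computability without an oracle is computability relative to the zero oracle. *)
definition computes :: "nat \<Rightarrow> (nat list \<Rightarrow> nat) \<Rightarrow> bool" where
  "computes e F \<longleftrightarrow> (\<forall>\<sigma>. eval (\<lambda>_. 0) (prog_of e) (list_encode \<sigma>) = Some (F \<sigma>))"

definition learner :: "(nat list \<Rightarrow> nat) \<Rightarrow> bool" where
  "learner \<Psi> \<longleftrightarrow> (\<exists>e. computes e \<Psi>)"

(* An enumeration of all learners by program numbers. The total computable functions have no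
   uniformly computable enumeration, so programs that are not total on strings are replaced
   by the constant learner 0. *)
definition Psi :: "nat \<Rightarrow> nat list \<Rightarrow> nat" where
  "Psi e = (if \<exists>F. computes e F then (THE F. computes e F) else (\<lambda>_. 0))"

lemma Psi_eqI: "computes e F \<Longrightarrow> Psi e = F"
proof -
  assume F: "computes e F"
  have "G = F" if "computes e G" for G
    using that F by (auto simp: computes_def)
  with F have "(THE G. computes e G) = F"
    by blast
  then show ?thesis
    using F by (auto simp: Psi_def)
qed

lemma range_Psi: "range Psi = {\<Psi>. learner \<Psi>}"
proof (intro equalityI subsetI)
  fix \<Psi> assume "\<Psi> \<in> range Psi"
  then obtain e where e: "\<Psi> = Psi e" by blast
  have "computes 0 (\<lambda>_. 0)"
    by (simp add: computes_def prog_of.simps)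
  then show "\<Psi> \<in> {\<Psi>. learner \<Psi>}"
    by (cases "\<exists>F. computes e F") (auto simp: e learner_def Psi_eqI, auto simp: Psi_def)
qed (auto simp: learner_def dest: Psi_eqI)

definition identifies :: "(nat list \<Rightarrow> nat) \<Rightarrow> pfun \<Rightarrow> (nat \<Rightarrow> nat) \<Rightarrow> bool" where
  "identifies \<Psi> \<Gamma> g \<longleftrightarrow> (\<exists>e. (\<lambda>n. \<Psi> (initseg g n)) \<longlonglongrightarrow> e \<and> Phi e g = \<Gamma> g)"

definition computable_1_omega :: "pfun \<Rightarrow> bool" where
  "computable_1_omega \<Gamma> \<longleftrightarrow> (\<exists>\<Psi>. learner \<Psi> \<and> (\<forall>g\<in>dom \<Gamma>. identifies \<Psi> \<Gamma> g))"

definition computable_fin_1 :: "pfun \<Rightarrow> bool" where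
  "computable_fin_1 \<Gamma> \<longleftrightarrow> (\<exists>b. \<forall>g\<in>dom \<Gamma>. \<exists>e<b. \<Gamma> g = Phi e g)"

definition computable_fin_omega :: "pfun \<Rightarrow> bool" where
  "computable_fin_omega \<Gamma> \<longleftrightarrow> (\<exists>b. \<forall>g\<in>dom \<Gamma>. \<exists>e<b. identifies (Psi e) \<Gamma> g)"

(* The first argument is the class of (alpha,beta)-computable partial functions. *)
definition reducible :: "(pfun \<Rightarrow> bool) \<Rightarrow> (nat \<Rightarrow> nat) set \<Rightarrow> (nat \<Rightarrow> nat) set \<Rightarrow> bool" where
  "reducible C A B \<longleftrightarrow> (\<exists>\<Gamma>. C \<Gamma> \<and> B \<subseteq> dom \<Gamma> \<and> (\<forall>g\<in>B. the (\<Gamma> g) \<in> A))"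

definition equivalent :: "(pfun \<Rightarrow> bool) \<Rightarrow> (nat \<Rightarrow> nat) set \<Rightarrow> (nat \<Rightarrow> nat) set \<Rightarrow> bool" where
  "equivalent C A B \<longleftrightarrow> reducible C A B \<and> reducible C B A"

definition strictly_reducible ::
    "(pfun \<Rightarrow> bool) \<Rightarrow> (nat \<Rightarrow> nat) set \<Rightarrow> (nat \<Rightarrow> nat) set \<Rightarrow> bool" where
  "strictly_reducible C A B \<longleftrightarrow> reducible C A B \<and> \<not> reducible C B A"

definition cantor_space :: "(nat \<Rightarrow> nat) set" where
  "cantor_space = {f. \<forall>n. f n < 2}"

definition Pi01 :: "(nat \<Rightarrow> nat) set \<Rightarrow> bool" where
  "Pi01 P \<longleftrightarrow> (\<exists>R. (\<exists>e. computes e (\<lambda>\<sigma>. of_bool (R \<sigma>))) \<and> P = {f. \<forall>n. R (initseg f n)})"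

end

theory Submission
  imports Defs
begin

text \<open>One pair \<open>P\<close>, \<open>Q\<close> serves both parts. There are two mass problems \<open>solutions 0\<close> and
  \<open>solutions 1\<close>, each of them a box of functions whose values avoid, coordinate by coordinate, uniformly
  c.e. sets, such that neither is uniformly reducible to the other. A member of \<open>Q\<close> is
  a solution of one of the two problems, labelled by which. A member of \<open>P\<close> is a sequence of labelled
  finite approximations, the \<open>i\<close>-th of which is a partial solution of the problem of its own choice
  on the coordinates up to \<open>i\<close>.

  A member of \<open>Q\<close> computes the sequence of its truncations. Conversely some label occurs infinitely
  often in a given member of \<open>P\<close>, and for each label there is a program that searches for the
  approximations with this label, so two programs suffice. No learner suffices: by the Baire category
  theorem a learner is constant on all members of \<open>P\<close> extending some finite sequence of rows. The
  program it settles on decides after finitely many further rows which problem to solve; continuing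
  with rows obtained from a solution of the other problem gives a uniform reduction between the two
  problems.

  The two problems are made independent without injury. To prevent program \<open>e\<close> from mapping
  solutions of problem \<open>l\<close> to solutions of problem \<open>1 - l\<close>, values at coordinate \<open>e\<close> of problem
  \<open>1 - l\<close> are killed. Coordinates of both problems are interleaved into one sequence, along which the
  numbers \<open>width N\<close> of possible values grow so fast that a whole set of at most \<open>threshold N\<close> killed
  values is negligible. For each choice of values at the lower coordinates of problem \<open>l\<close> we kill the
  first value that is found to be unavoidable: it is still produced by the program on some oracle
  whichever \<open>threshold\<close> many values are later killed at each higher coordinate. If no value is
  unavoidable, then all of them can be avoided simultaneously.\<close>

section \<open>Computable functionals\<close>

text \<open>One program has to halt on every oracle and every argument, so composition needs no
  definedness conditions; unbounded search is treated separately.\<close>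

definition computable_functional :: "((nat \<Rightarrow> nat) \<Rightarrow> nat \<Rightarrow> nat) \<Rightarrow> bool" where
  "computable_functional F \<longleftrightarrow> (\<exists>p. \<forall>g x. eval g p x = Some (F g x))"

abbreviation decidable :: "((nat \<Rightarrow> nat) \<Rightarrow> nat \<Rightarrow> bool) \<Rightarrow> bool" where
  "decidable P \<equiv> computable_functional (\<lambda>g x. of_bool (P g x))"

abbreviation pair :: "nat \<Rightarrow> nat \<Rightarrow> nat" where
  "pair x y \<equiv> prod_encode (x, y)"

abbreviation pfst :: "nat \<Rightarrow> nat" where
  "pfst z \<equiv> fst (prod_decode z)"

abbreviation psnd :: "nat \<Rightarrow> nat" where
  "psnd z \<equiv> snd (prod_decode z)"

lemma pair_decode: "pair (pfst z) (psnd z) = z"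
  by simp

named_theorems computable_intros

lemma computable_const [computable_intros]: "computable_functional (\<lambda>g x. c)"
proof -
  have "\<exists>p. \<forall>g x. eval g p x = Some c"
  proof (induction c)
    case 0
    show ?case by (rule exI[of _ Zero]) simp
  next
    case (Suc c)
    then obtain p where "\<forall>g x. eval g p x = Some c" by blast
    then show ?case by (intro exI[of _ "Comp Succ p"]) simp
  qed
  then show ?thesis by (simp add: computable_functional_def)
qed

lemma computable_comp:
  assumes "computable_functional F" "computable_functional G"
  shows "computable_functional (\<lambda>g x. F g (G g x))"
proof -
  obtain p q where "\<forall>g x. eval g p x = Some (F g x)" "\<forall>g x. eval g q x = Some (G g x)"
    using assms by (auto simp: computable_functional_def)
  then show ?thesis
    unfolding computable_functional_def by (intro exI[of _ "Comp p q"]) simp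
qed

lemma computable_pair [computable_intros]:
  assumes "computable_functional F" "computable_functional G"
  shows "computable_functional (\<lambda>g x. pair (F g x) (G g x))"
proof -
  obtain p q where "\<forall>g x. eval g p x = Some (F g x)" "\<forall>g x. eval g q x = Some (G g x)"
    using assms by (auto simp: computable_functional_def)
  then show ?thesis
    unfolding computable_functional_def by (intro exI[of _ "Paired p q"]) simp
qed

lemma computable_id [computable_intros]: "computable_functional (\<lambda>g x. x)"
  unfolding computable_functional_def by (rule exI[of _ "Paired First Second"]) simp

lemma computable_Suc [computable_intros]:
  "computable_functional F \<Longrightarrow> computable_functional (\<lambda>g x. Suc (F g x))"
  by (rule computable_comp[of "\<lambda>g. Suc"])
    (auto simp: computable_functional_def intro!: exI[of _ Succ])

lemma computable_pfst [computable_intros]: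
  "computable_functional F \<Longrightarrow> computable_functional (\<lambda>g x. pfst (F g x))"
  by (rule computable_comp[of "\<lambda>g. pfst"])
    (auto simp: computable_functional_def intro!: exI[of _ First])

lemma computable_psnd [computable_intros]:
  "computable_functional F \<Longrightarrow> computable_functional (\<lambda>g x. psnd (F g x))"
  by (rule computable_comp[of "\<lambda>g. psnd"])
    (auto simp: computable_functional_def intro!: exI[of _ Second])

lemma computable_oracle [computable_intros]:
  "computable_functional F \<Longrightarrow> computable_functional (\<lambda>g x. g (F g x))"
  by (rule computable_comp[of "\<lambda>g. g"])
    (auto simp: computable_functional_def intro!: exI[of _ Oracle])

text \<open>Parameter, counter and previous value are packed the way \<open>PrimRec\<close> passes
  them. A similar packing handles the bound variables of sums and bounded quantifiers below.\<close>

lemma computable_rec [computable_intros]: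
  assumes "computable_functional N" "computable_functional A"
    and "computable_functional (\<lambda>g z. B g (pfst z) (pfst (psnd z)) (psnd (psnd z)))"
  shows "computable_functional (\<lambda>g x. rec_nat (A g x) (\<lambda>i r. B g x i r) (N g x))"
proof -
  obtain p where p: "\<forall>g x. eval g p x = Some (A g x)"
    using assms by (auto simp: computable_functional_def)
  obtain q where q: "\<forall>g z. eval g q z = Some (B g (pfst z) (pfst (psnd z)) (psnd (psnd z)))"
    using assms by (auto simp: computable_functional_def)
  have "eval g (PrimRec p q) (pair x k) = Some (rec_nat (A g x) (\<lambda>i r. B g x i r) k)" for g x k
    by (induction k) (use p q in auto)
  then have "eval g (PrimRec p q) z = Some (rec_nat (A g (pfst z)) (\<lambda>i r. B g (pfst z) i r) (psnd z))" for g z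
    by (metis pair_decode)
  then have "computable_functional (\<lambda>g z. rec_nat (A g (pfst z)) (\<lambda>i r. B g (pfst z) i r) (psnd z))"
    unfolding computable_functional_def by blast
  from computable_comp[OF this computable_pair[OF computable_id assms(1)]]
  show ?thesis by simp
qed

lemma computable_pred: "computable_functional F \<Longrightarrow> computable_functional (\<lambda>g x. F g x - 1)"
proof -
  assume "computable_functional F"
  then have "computable_functional (\<lambda>g x. rec_nat 0 (\<lambda>i r. i) (F g x))"
    by (intro computable_intros)
  moreover have "rec_nat 0 (\<lambda>i r. i) n = n - 1" for n :: nat by (cases n) auto
  ultimately show ?thesis by simp
qed

lemma computable_add [computable_intros]:
  assumes "computable_functional F" "computable_functional G"
  shows "computable_functional (\<lambda>g x. F g x + G g x)"
proof -
  have "computable_functional (\<lambda>g x. rec_nat (F g x) (\<lambda>i r. Suc r) (G g x))"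
    by (intro computable_intros assms)
  moreover have "rec_nat m (\<lambda>i r. Suc r) n = m + n" for m n by (induction n) auto
  ultimately show ?thesis by simp
qed

lemma computable_diff [computable_intros]:
  assumes "computable_functional F" "computable_functional G"
  shows "computable_functional (\<lambda>g x. F g x - G g x)"
proof -
  have "computable_functional (\<lambda>g x. rec_nat (F g x) (\<lambda>i r. r - 1) (G g x))"
    by (intro computable_intros computable_pred assms)
  moreover have "rec_nat m (\<lambda>i r. r - 1) n = m - n" for m n :: nat by (induction n) auto
  ultimately show ?thesis by simp
qed

lemma computable_mult [computable_intros]:
  assumes "computable_functional F" "computable_functional G"
  shows "computable_functional (\<lambda>g x. F g x * G g x)"
proof -
  have "computable_functional (\<lambda>g x. rec_nat 0 (\<lambda>i r. r + F g x) (G g x))"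
    by (intro computable_intros assms computable_comp[OF assms(1)])
  moreover have "rec_nat 0 (\<lambda>i r. r + m) n = m * n" for m n :: nat by (induction n) auto
  ultimately show ?thesis by simp
qed

lemma computable_power [computable_intros]:
  assumes "computable_functional F" "computable_functional G"
  shows "computable_functional (\<lambda>g x. F g x ^ G g x)"
proof -
  have "computable_functional (\<lambda>g x. rec_nat 1 (\<lambda>i r. r * F g x) (G g x))"
    by (intro computable_intros assms computable_comp[OF assms(1)])
  moreover have "rec_nat 1 (\<lambda>i r. r * m) n = m ^ n" for m n :: nat by (induction n) auto
  ultimately show ?thesis by simp
qed

lemma computable_sum [computable_intros]:
  assumes "computable_functional (\<lambda>g z. F g (pfst z) (psnd z))" "computable_functional N"
  shows "computable_functional (\<lambda>g x. \<Sum>j<N g x. F g x j)"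
proof -
  have "computable_functional (\<lambda>g z. F g (pfst z) (pfst (psnd z)))"
    using computable_comp[OF assms(1), of "\<lambda>g z. pair (pfst z) (pfst (psnd z))"]
    by (simp add: computable_intros)
  then have "computable_functional (\<lambda>g x. rec_nat 0 (\<lambda>i r. r + F g x i) (N g x))"
    by (intro computable_intros assms)
  moreover have "rec_nat 0 (\<lambda>i r. r + f i) n = (\<Sum>j<n. f j)" for f :: "nat \<Rightarrow> nat" and n
    by (induction n) auto
  ultimately show ?thesis by simp
qed

lemma computable_funpow:
  assumes "computable_functional N" "computable_functional A" "computable_functional (\<lambda>g. f)"
  shows "computable_functional (\<lambda>g x. (f ^^ N g x) (A g x))"
proof -
  have "computable_functional (\<lambda>g x. rec_nat (A g x) (\<lambda>i r. f r) (N g x))"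
    by (intro computable_intros assms computable_comp[OF assms(3)])
  moreover have "rec_nat a (\<lambda>i r. f r) n = (f ^^ n) a" for a n by (induction n) auto
  ultimately show ?thesis by simp
qed

section \<open>Decidable predicates and bounded quantifiers\<close>

lemma decidable_not [computable_intros]:
  assumes "decidable P" shows "decidable (\<lambda>g x. \<not> P g x)"
proof -
  have "computable_functional (\<lambda>g x. 1 - of_bool (P g x))"
    by (intro computable_intros assms)
  moreover have "1 - of_bool b = (of_bool (\<not> b) :: nat)" for b by simp
  ultimately show ?thesis by (simp only:)
qed

lemma decidable_conj [computable_intros]:
  assumes "decidable P" "decidable Q" shows "decidable (\<lambda>g x. P g x \<and> Q g x)"
  unfolding of_bool_conj by (intro computable_intros assms)

lemma decidable_disj [computable_intros]:
  assumes "decidable P" "decidable Q" shows "decidable (\<lambda>g x. P g x \<or> Q g x)"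
proof -
  have "decidable (\<lambda>g x. \<not> (\<not> P g x \<and> \<not> Q g x))"
    by (intro computable_intros assms)
  then show ?thesis by simp
qed

lemma decidable_imp [computable_intros]:
  assumes "decidable P" "decidable Q" shows "decidable (\<lambda>g x. P g x \<longrightarrow> Q g x)"
  unfolding imp_conv_disj by (intro computable_intros assms)

lemma decidable_less [computable_intros]:
  assumes "computable_functional F" "computable_functional G"
  shows "decidable (\<lambda>g x. F g x < G g x)"
proof -
  have "computable_functional (\<lambda>g x. 1 - (1 - (G g x - F g x)))"
    by (intro computable_intros assms)
  moreover have "1 - (1 - (n - m)) = of_bool (m < n)" for m n :: nat by auto
  ultimately show ?thesis by simp
qed

lemma decidable_le [computable_intros]:
  assumes "computable_functional F" "computable_functional G"
  shows "decidable (\<lambda>g x. F g x \<le> G g x)"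
  unfolding not_less[symmetric] by (intro computable_intros assms)

lemma decidable_eq [computable_intros]:
  assumes "computable_functional F" "computable_functional G"
  shows "decidable (\<lambda>g x. F g x = G g x)"
  unfolding order_eq_iff by (intro computable_intros assms)

lemma decidable_ex_less [computable_intros]:
  assumes "decidable (\<lambda>g z. P g (pfst z) (psnd z))" "computable_functional N"
  shows "decidable (\<lambda>g x. \<exists>j<N g x. P g x j)"
proof -
  have "decidable (\<lambda>g x. \<not> (\<Sum>j<N g x. of_bool (P g x j) :: nat) = 0)"
    by (intro computable_intros assms)
  moreover have "\<not> (\<Sum>j<n. of_bool (p j) :: nat) = 0 \<longleftrightarrow> (\<exists>j<n. p j)" for n :: nat and p
    by auto
  ultimately show ?thesis by simp
qed

lemma decidable_all_less [computable_intros]: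
  assumes "decidable (\<lambda>g z. P g (pfst z) (psnd z))" "computable_functional N"
  shows "decidable (\<lambda>g x. \<forall>j<N g x. P g x j)"
proof -
  have "decidable (\<lambda>g x. \<not> (\<exists>j<N g x. \<not> P g x j))"
    by (intro computable_intros assms)
  then show ?thesis by simp
qed

lemma computable_if [computable_intros]:
  assumes "decidable P" "computable_functional F" "computable_functional G"
  shows "computable_functional (\<lambda>g x. if P g x then F g x else G g x)"
proof -
  have "computable_functional (\<lambda>g x. of_bool (P g x) * F g x + of_bool (\<not> P g x) * G g x)"
    by (intro computable_intros assms)
  moreover have "of_bool c * a + of_bool (\<not> c) * b = (if c then a else b)" for a b :: nat and c
    by simp
  ultimately show ?thesis by simp
qed

lemma computable_div [computable_intros]:
  assumes "computable_functional F" "computable_functional G"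
  shows "computable_functional (\<lambda>g x. F g x div G g x)"
proof -
  \<comment> \<open>The quotient of m by n counts the q with (q + 1) n at most m, all of them below
    m; the guard 0 < n yields the convention that division by 0 gives 0.\<close>
  have "computable_functional (\<lambda>g x. \<Sum>q<F g x. of_bool (0 < G g x \<and> Suc q * G g x \<le> F g x))"
    by (intro computable_intros assms computable_comp[OF assms(1)] computable_comp[OF assms(2)])
  moreover have "(\<Sum>q<m. of_bool (0 < n \<and> Suc q * n \<le> m)) = m div n" for m n :: nat
  proof (cases "n = 0")
    case False
    then have iff: "0 < n \<and> Suc q * n \<le> m \<longleftrightarrow> q < m div n" for q
      by (metis Suc_le_eq less_eq_div_iff_mult_less_eq neq0_conv)
    have "{..<m} \<inter> {q. q < m div n} = {..<m div n}"
      by (auto intro: less_le_trans[OF _ div_le_dividend])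
    then show ?thesis
      unfolding iff by (simp add: of_bool_def sum.If_cases)
  qed simp
  ultimately show ?thesis by simp
qed

lemma computable_mod [computable_intros]:
  assumes "computable_functional F" "computable_functional G"
  shows "computable_functional (\<lambda>g x. F g x mod G g x)"
  unfolding modulo_nat_def by (intro computable_intros assms)

lemma decidable_finite:
  assumes "finite D"
  shows "decidable (\<lambda>g x. x \<in> D)"
  using assms
proof (induction rule: finite_induct)
  case (insert a D)
  have "decidable (\<lambda>g x. x = a \<or> x \<in> D)"
    by (intro computable_intros insert.IH)
  then show ?case by simp
qed (simp add: computable_intros)

lemma computable_functional_index:
  assumes "computable_functional F"
  shows "\<exists>e. \<forall>g x. eval g (prog_of e) x = Some (F g x)"
proof -
  obtain p where "\<forall>g x. eval g p x = Some (F g x)"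
    using assms by (auto simp: computable_functional_def)
  moreover obtain e where "p = prog_of e"
    using surj_prog_of by (rule surjE)
  ultimately show ?thesis by blast
qed

primrec subst_oracle :: "prog \<Rightarrow> prog \<Rightarrow> prog" where
  "subst_oracle r Zero = Zero"
| "subst_oracle r Succ = Succ"
| "subst_oracle r First = First"
| "subst_oracle r Second = Second"
| "subst_oracle r Oracle = r"
| "subst_oracle r (Paired p q) = Paired (subst_oracle r p) (subst_oracle r q)"
| "subst_oracle r (Comp p q) = Comp (subst_oracle r p) (subst_oracle r q)"
| "subst_oracle r (PrimRec p q) = PrimRec (subst_oracle r p) (subst_oracle r q)"
| "subst_oracle r (Mu p) = Mu (subst_oracle r p)"

text \<open>Composition of reductions: oracle queries are answered by running r, which computes h
  from g.\<close>

lemma eval_subst_oracle: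
  assumes "\<And>x. eval g r x = Some (h x)"
  shows "eval g (subst_oracle r p) = eval h p"
proof -
  have "eval g r = (\<lambda>x. Some (h x))"
    by (rule ext) (rule assms)
  then show ?thesis by (induction p) simp_all
qed

lemma eval_Mu_total:
  assumes "\<And>k. eval g p (pair x k) = Some (F k)" "\<exists>k. F k = 0"
  shows "eval g (Mu p) x = Some (LEAST k. F k = 0)"
  using assms by simp

section \<open>Codes of lists\<close>

abbreviation chd :: "nat \<Rightarrow> nat" where
  "chd w \<equiv> pfst (w - 1)"

text \<open>A nonempty list is coded by the successor of the pair of its head and the code of its
  tail. At 0, the code of the empty list, head and tail are both 0, so iterating past the end is
  harmless.\<close>

definition ctl :: "nat \<Rightarrow> nat" where
  "ctl w = psnd (w - 1)"

lemma prod_decode_0 [simp]: "prod_decode 0 = (0, 0)"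
  by (simp add: prod_decode_def prod_decode_aux.simps)

lemma computable_ctl: "computable_functional (\<lambda>g. ctl)"
  unfolding ctl_def by (intro computable_intros)

lemma list_decode_ctl: "list_decode (ctl w) = tl (list_decode w)"
  by (cases w) (auto simp: ctl_def split: prod.splits)

lemma list_decode_ctl_funpow: "list_decode ((ctl ^^ n) w) = drop n (list_decode w)"
  by (induction n) (auto simp: list_decode_ctl drop_Suc tl_drop)

lemma list_decode_eq_Nil: "list_decode w = [] \<longleftrightarrow> w = 0"
  by (metis list_decode.simps(1) list_decode_inverse list_encode.simps(1))

lemma hd_list_decode: "w \<noteq> 0 \<Longrightarrow> hd (list_decode w) = chd w"
  by (cases w) (auto split: prod.splits)

lemma length_le_list_encode: "length xs \<le> list_encode xs"
proof (induction xs)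
  case (Cons a xs)
  then show ?case using le_prod_encode_2[of "list_encode xs" a] by simp
qed simp

lemma mem_less_list_encode: "c \<in> set xs \<Longrightarrow> c < list_encode xs"
proof (induction xs)
  case (Cons a xs)
  then show ?case
    using le_prod_encode_1[of a "list_encode xs"] le_prod_encode_2[of "list_encode xs" a] by auto
qed simp

lemma ctl_funpow_eq_0: "(ctl ^^ n) w = 0 \<longleftrightarrow> length (list_decode w) \<le> n"
  by (metis drop_eq_Nil list_decode_ctl_funpow list_decode_eq_Nil)

lemma computable_ctl_funpow [computable_intros]:
  assumes "computable_functional N" "computable_functional F"
  shows "computable_functional (\<lambda>g x. (ctl ^^ N g x) (F g x))"
  by (intro computable_funpow computable_ctl assms)

lemma computable_length [computable_intros]:
  assumes "computable_functional F"
  shows "computable_functional (\<lambda>g x. length (list_decode (F g x)))"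
proof -
  have "computable_functional (\<lambda>g x. \<Sum>n<F g x. of_bool ((ctl ^^ n) (F g x) \<noteq> 0))"
    by (intro computable_intros assms computable_comp[OF assms])
  moreover have "(\<Sum>n<w. of_bool ((ctl ^^ n) w \<noteq> 0)) = length (list_decode w)" for w
  proof -
    have "length (list_decode w) \<le> w"
      using length_le_list_encode[of "list_decode w"] by simp
    then have "{..<w} \<inter> {n. (ctl ^^ n) w \<noteq> 0} = {..<length (list_decode w)}"
      by (auto simp: ctl_funpow_eq_0)
    then show ?thesis
      by (simp add: of_bool_def sum.If_cases)
  qed
  ultimately show ?thesis by simp
qed

text \<open>The default 0 is what \<open>chd\<close> returns on the empty list, so lookup is the
  head of an iterated tail for every index.\<close>

definition lnth :: "nat list \<Rightarrow> nat \<Rightarrow> nat" where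
  "lnth xs i = (if i < length xs then xs ! i else 0)"

lemma lnth_list_decode: "lnth (list_decode w) i = chd ((ctl ^^ i) w)"
proof (cases "i < length (list_decode w)")
  case True
  then have "(ctl ^^ i) w \<noteq> 0" by (simp add: ctl_funpow_eq_0)
  from hd_list_decode[OF this] show ?thesis
    using True by (simp add: lnth_def list_decode_ctl_funpow hd_drop_conv_nth)
next
  case False
  then show ?thesis using ctl_funpow_eq_0[of i w] by (simp add: lnth_def)
qed

lemma computable_lnth [computable_intros]:
  assumes "computable_functional F" "computable_functional N"
  shows "computable_functional (\<lambda>g x. lnth (list_decode (F g x)) (N g x))"
  unfolding lnth_list_decode by (intro computable_intros assms)

lemma decidable_list_mem [computable_intros]:
  assumes "computable_functional C" "computable_functional F"
  shows "decidable (\<lambda>g x. C g x \<in> set (list_decode (F g x)))"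
proof -
  have "decidable (\<lambda>g x. \<exists>i<length (list_decode (F g x)). lnth (list_decode (F g x)) i = C g x)"
    by (intro computable_intros assms computable_comp[OF assms(1)] computable_comp[OF assms(2)])
  moreover have "(\<exists>i<length xs. lnth xs i = c) \<longleftrightarrow> c \<in> set xs" for c xs
    by (auto simp: lnth_def in_set_conv_nth)
  ultimately show ?thesis by simp
qed

section \<open>Strings\<close>

text \<open>A string is the code of the list of its entries in reverse order, so that appending an entry is
  a list constructor.\<close>

abbreviation len :: "nat \<Rightarrow> nat" where
  "len s \<equiv> length (list_decode s)"

definition snoc :: "nat \<Rightarrow> nat \<Rightarrow> nat" where
  "snoc s j = Suc (pair j s)"

definition entry :: "nat \<Rightarrow> nat \<Rightarrow> nat" where
  "entry s i = lnth (list_decode s) (len s - Suc i)"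

primrec prefix_code :: "(nat \<Rightarrow> nat) \<Rightarrow> nat \<Rightarrow> nat" where
  "prefix_code g 0 = 0"
| "prefix_code g (Suc n) = snoc (prefix_code g n) (g n)"

lemma length_initseg [simp]: "length (initseg g n) = n"
  by (simp add: initseg_def)

lemma lnth_initseg [simp]: "i < n \<Longrightarrow> lnth (initseg g n) i = g i"
  by (simp add: initseg_def lnth_def)

definition prefix_of :: "nat \<Rightarrow> (nat \<Rightarrow> nat) \<Rightarrow> bool" where
  "prefix_of s g \<longleftrightarrow> (\<forall>i<len s. entry s i = g i)"

lemma list_decode_snoc: "list_decode (snoc s j) = j # list_decode s"
  by (simp add: snoc_def)

lemma len_snoc [simp]: "len (snoc s j) = Suc (len s)"
  by (simp add: list_decode_snoc)

lemma entry_snoc [simp]: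
  "entry (snoc s j) i = (if i < len s then entry s i else j)"
proof (cases "i < len s")
  case True
  then have "len s - i = Suc (len s - Suc i)" by simp
  then show ?thesis using True by (simp add: entry_def lnth_def list_decode_snoc)
qed (simp add: entry_def lnth_def list_decode_snoc)

lemma len_prefix_code [simp]: "len (prefix_code g n) = n"
  by (induction n) auto

lemma entry_prefix_code [simp]: "i < n \<Longrightarrow> entry (prefix_code g n) i = g i"
  by (induction n) (auto simp: less_Suc_eq)

lemma computable_snoc [computable_intros]:
  assumes "computable_functional F" "computable_functional G"
  shows "computable_functional (\<lambda>g x. snoc (F g x) (G g x))"
  unfolding snoc_def by (intro computable_intros assms)

lemma computable_entry [computable_intros]:
  assumes "computable_functional F" "computable_functional G"
  shows "computable_functional (\<lambda>g x. entry (F g x) (G g x))"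
  unfolding entry_def by (intro computable_intros assms)

section \<open>Certificates\<close>

text \<open>A claim is either that program \<open>e\<close> maps \<open>x\<close> to \<open>y\<close> relative to every oracle extending \<open>s\<close>, or that
  the value \<open>v\<close> of the computation attacked by requirement \<open>N\<close> is unavoidable from \<open>s\<close> on. A certificate
  is a list of claims each of which is justified by the claims after it.

  Requirement \<open>N = 2 * e + k\<close> attacks program \<open>e\<close> as a reduction of problem \<open>k\<close> to problem \<open>1 - k\<close>, at
  argument \<open>e\<close>. The \<open>i\<close>-th coordinate of problem \<open>l\<close> is number \<open>2 * i + l\<close> in the common sequence.\<close>

definition threshold :: "nat \<Rightarrow> nat" where
  "threshold N = 2 ^ 4 ^ N"

text \<open>As \<open>threshold (Suc N) = threshold N ^ 4\<close>, the exponent 3 meets two needs: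
  the product of the widths at the lower coordinates of one problem is at most the threshold
  (\<open>finite_card_low_strings\<close>), yet each width outgrows what is lost at its coordinate
  (\<open>width_bound\<close>).\<close>

definition width :: "nat \<Rightarrow> nat" where
  "width N = threshold N ^ 3"

lemma computable_width [computable_intros]:
  "computable_functional F \<Longrightarrow> computable_functional (\<lambda>g x. width (F g x))"
  unfolding width_def threshold_def by (intro computable_intros)

definition eval_claim :: "nat \<Rightarrow> nat \<Rightarrow> nat \<Rightarrow> nat \<Rightarrow> nat" where
  "eval_claim s e x y = pair 0 (pair s (pair e (pair x y)))"

definition vote_claim :: "nat \<Rightarrow> nat \<Rightarrow> nat \<Rightarrow> nat" where
  "vote_claim N v s = pair 1 (pair N (pair v s))"

text \<open>For N of parity k the oracle is to solve problem 1 - k, whose coordinates are numbered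
  here; N itself is the number of the coordinate of problem k at which requirement N kills
  values.\<close>

abbreviation coord :: "nat \<Rightarrow> nat \<Rightarrow> nat" where
  "coord N i \<equiv> 2 * i + (1 - N mod 2)"

text \<open>The clauses mirror \<open>eval\<close> along the Goedel numbering. Oracle queries are
  answered only inside the string, and S occurs only positively, which gives monotonicity.\<close>

definition justified_eval :: "nat set \<Rightarrow> nat \<Rightarrow> nat \<Rightarrow> nat \<Rightarrow> nat \<Rightarrow> bool" where
  "justified_eval S s e x y \<longleftrightarrow>
     (let m = (e - 5) div 4; r = (e - 5) mod 4; a = pfst m; b = psnd m in
      if e = 0 then y = 0 else if e = 1 then y = Suc x else if e = 2 then y = pfst x
      else if e = 3 then y = psnd x else if e = 4 then x < len s \<and> y = entry s x
      else if r = 0 then eval_claim s a x (pfst y) \<in> S \<and> eval_claim s b x (psnd y) \<in> S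
      else if r = 1 then \<exists>z. eval_claim s b x z \<in> S \<and> eval_claim s a z y \<in> S
      else if r = 2 then
        if psnd x = 0 then eval_claim s a (pfst x) y \<in> S
        else \<exists>v. eval_claim s e (pair (pfst x) (psnd x - 1)) v \<in> S \<and>
                 eval_claim s b (pair (pfst x) (pair (psnd x - 1) v)) y \<in> S
      else eval_claim s m (pair x y) 0 \<in> S \<and>
           (\<forall>j<y. \<exists>v. eval_claim s m (pair x j) v \<in> S \<and> 0 < v))"

text \<open>The second clause is a majority vote over the next entry: at most threshold many values
  will ever be killed there, so one of the voters survives whatever these values are.\<close>

definition justified_vote :: "nat set \<Rightarrow> nat \<Rightarrow> nat \<Rightarrow> nat \<Rightarrow> bool" where
  "justified_vote S N v s \<longleftrightarrow>
     eval_claim s (N div 2) (N div 2) v \<in> S \<or>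
     threshold (coord N (len s)) <
       card {j. j < width (coord N (len s)) \<and> vote_claim N v (snoc s j) \<in> S}"

text \<open>Every number is read as a claim: any tag other than 0 counts as the tag of a vote, so
  there are no malformed codes.\<close>

definition justified :: "nat set \<Rightarrow> nat \<Rightarrow> bool" where
  "justified S c \<longleftrightarrow>
     (if pfst c = 0
      then justified_eval S (pfst (psnd c)) (pfst (psnd (psnd c)))
             (pfst (psnd (psnd (psnd c)))) (psnd (psnd (psnd (psnd c))))
      else justified_vote S (pfst (psnd c)) (pfst (psnd (psnd c))) (psnd (psnd (psnd c))))"

primrec valid :: "nat list \<Rightarrow> bool" where
  "valid [] = True"
| "valid (c # cs) = (justified (set cs) c \<and> valid cs)"

definition derivable :: "nat \<Rightarrow> bool" where
  "derivable c \<longleftrightarrow> (\<exists>cs. valid (c # cs))"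

lemma justified_eval_claim [simp]:
  "justified S (eval_claim s e x y) \<longleftrightarrow> justified_eval S s e x y"
  by (simp add: justified_def eval_claim_def)

lemma justified_vote_claim [simp]:
  "justified S (vote_claim N v s) \<longleftrightarrow> justified_vote S N v s"
  by (simp add: justified_def vote_claim_def)

lemma justified_eval_mono: "justified_eval S s e x y \<Longrightarrow> S \<subseteq> T \<Longrightarrow> justified_eval T s e x y"
  unfolding justified_eval_def Let_def by (simp split: if_splits) blast+

lemma justified_vote_mono:
  assumes "justified_vote S N v s" "S \<subseteq> T"
  shows "justified_vote T N v s"
proof -
  have "card {j. j < n \<and> f j \<in> S} \<le> card {j. j < n \<and> f j \<in> T}" for n :: nat and f
    using assms(2) by (intro card_mono) auto
  then show ?thesis
    using assms unfolding justified_vote_def by (meson less_le_trans subsetD)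
qed

lemma justified_mono: "justified S c \<Longrightarrow> S \<subseteq> T \<Longrightarrow> justified T c"
  unfolding justified_def by (auto intro: justified_eval_mono justified_vote_mono split: if_splits)

lemma valid_append: "valid cs \<Longrightarrow> valid ds \<Longrightarrow> valid (cs @ ds)"
  by (induction cs) (auto elim: justified_mono)

lemma derivable_mem: "valid cs \<Longrightarrow> c \<in> set cs \<Longrightarrow> derivable c"
  by (induction cs) (auto simp: derivable_def)

text \<open>By monotonicity certificates can be concatenated, so finitely many derivable premises
  share one certificate.\<close>

lemma derivableI:
  assumes "justified T c" "finite T" "\<And>d. d \<in> T \<Longrightarrow> derivable d"
  shows "derivable c"
proof -
  have "\<exists>cs. valid cs \<and> T \<subseteq> set cs"
    using assms(2,3)
  proof (induction T rule: finite_induct)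
    case (insert d T)
    then obtain cs where "valid cs" "T \<subseteq> set cs" by auto
    moreover obtain ds where "valid (d # ds)"
      using insert.prems[of d] unfolding derivable_def by blast
    ultimately show ?case
      using valid_append[of "d # ds" cs] by (intro exI[of _ "(d # ds) @ cs"]) auto
  qed (auto intro: exI[of _ "[]"])
  then show ?thesis
    using assms(1) justified_mono unfolding derivable_def by (metis valid.simps(2))
qed

lemma valid_iff_nth:
  "valid cs \<longleftrightarrow> (\<forall>i<length cs. justified (set (drop (Suc i) cs)) (cs ! i))"
  by (induction cs) (auto simp: All_less_Suc2)

section \<open>Decidability of certificates\<close>

lemma eval_claim_bound:
  assumes "eval_claim s e x y \<in> set (list_decode w)"
  shows "y < w"
proof -
  have "y \<le> eval_claim s e x y"
    unfolding eval_claim_def by (meson le_prod_encode_2 le_trans)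
  then show ?thesis
    using mem_less_list_encode[OF assms] by simp
qed

text \<open>A witness is part of a listed claim and hence smaller than the code of the list. This
  turns the existential clauses of \<open>justified_eval\<close> into bounded, decidable
  ones.\<close>

lemma ex_eval_claim_bound:
  "(\<exists>z. eval_claim s e x z \<in> set (list_decode w) \<and> P z) \<longleftrightarrow>
   (\<exists>z<w. eval_claim s e x z \<in> set (list_decode w) \<and> P z)"
  by (meson eval_claim_bound)

lemma card_less_eq_sum: "card {j. j < n \<and> P j} = (\<Sum>j<n. of_bool (P j))" for n :: nat
proof -
  have "{j. j < n \<and> P j} = {..<n} \<inter> {j. P j}" by auto
  then show ?thesis by (simp add: of_bool_def sum.If_cases)
qed

lemma decidable_if [computable_intros]:
  assumes "decidable P" "decidable Q" "decidable R"
  shows "decidable (\<lambda>g x. if P g x then Q g x else R g x)"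
proof -
  have "decidable (\<lambda>g x. (P g x \<longrightarrow> Q g x) \<and> (\<not> P g x \<longrightarrow> R g x))"
    by (intro computable_intros assms)
  then show ?thesis by (simp add: if_bool_eq_conj)
qed

lemma decidable_justified:
  "decidable (\<lambda>g z. justified (set (list_decode (pfst z))) (psnd z))"
  unfolding justified_def justified_eval_def justified_vote_def Let_def ex_eval_claim_bound
    card_less_eq_sum threshold_def
  unfolding eval_claim_def vote_claim_def
  by (intro computable_intros)

lemma decidable_valid [computable_intros]:
  assumes "computable_functional F"
  shows "decidable (\<lambda>g x. valid (list_decode (F g x)))"
proof -
  have "valid (list_decode w) \<longleftrightarrow>
    (\<forall>i<len w. justified (set (list_decode ((ctl ^^ Suc i) w))) (lnth (list_decode w) i))" for w
    by (auto simp: valid_iff_nth lnth_def list_decode_ctl_funpow simp del: funpow.simps)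
  moreover have "decidable (\<lambda>g w. \<forall>i<len w. justified (set (list_decode ((ctl ^^ Suc i) w))) (lnth (list_decode w) i))"
    using computable_comp[OF decidable_justified,
        of "\<lambda>g z. pair ((ctl ^^ Suc (psnd z)) (pfst z)) (lnth (list_decode (pfst z)) (psnd z))"]
    by (intro computable_intros) (simp add: computable_intros del: funpow.simps)
  ultimately have "decidable (\<lambda>g w. valid (list_decode w))" by simp
  from computable_comp[OF this assms] show ?thesis .
qed

section \<open>Soundness and completeness of evaluation claims\<close>

lemma prog_of_compound:
  assumes "5 \<le> e"
  shows "prog_of e =
     (let m = (e - 5) div 4; r = (e - 5) mod 4; a = pfst m; b = psnd m
      in if r = 0 then Paired (prog_of a) (prog_of b)
         else if r = 1 then Comp (prog_of a) (prog_of b)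
         else if r = 2 then PrimRec (prog_of a) (prog_of b)
         else Mu (prog_of m))"
  using assms by (subst prog_of.simps) (simp add: Let_def)

lemma prog_of_basic:
  "prog_of 0 = Zero" "prog_of 1 = Succ" "prog_of 2 = First" "prog_of 3 = Second"
  "prog_of 4 = Oracle"
  by (simp_all add: prog_of.simps)

definition eval_true :: "nat \<Rightarrow> nat \<Rightarrow> nat \<Rightarrow> nat \<Rightarrow> bool" where
  "eval_true s e x y \<longleftrightarrow> (\<forall>g. prefix_of s g \<longrightarrow> eval g (prog_of e) x = Some y)"

lemma eval_MuI:
  assumes "eval g p (pair x y) = Some 0"
    and "\<And>j. j < y \<Longrightarrow> \<exists>v. eval g p (pair x j) = Some v \<and> 0 < v"
  shows "eval g (Mu p) x = Some y"
proof -
  define halts where "halts k \<longleftrightarrow> eval g p (pair x k) = Some 0 \<and>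
    (\<forall>j<k. eval g p (pair x j) \<noteq> None)" for k
  have "halts y" using assms by (force simp: halts_def)
  moreover have "y \<le> j" if "halts j" for j
    using that assms(2)[of j] by (cases "j < y") (auto simp: halts_def)
  ultimately have "(LEAST k. halts k) = y"
    by (rule Least_equality)
  with \<open>halts y\<close> have "(if \<exists>k. halts k then Some (LEAST k. halts k) else None) = Some y"
    by auto
  then show ?thesis
    by (simp only: halts_def eval.simps Let_def)
qed

lemma eval_MuD:
  assumes "eval g (Mu p) x = Some y"
  shows "eval g p (pair x y) = Some 0 \<and> (\<forall>j<y. \<exists>v. eval g p (pair x j) = Some v \<and> 0 < v)"
proof -
  define halts where "halts k \<longleftrightarrow> eval g p (pair x k) = Some 0 \<and>
    (\<forall>j<k. eval g p (pair x j) \<noteq> None)" for k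
  have "eval g (Mu p) x = (if \<exists>k. halts k then Some (LEAST k. halts k) else None)"
    by (simp only: halts_def eval.simps Let_def)
  with assms have y: "\<exists>k. halts k" "y = (LEAST k. halts k)"
    by (auto split: if_splits)
  then have "halts y" by (auto intro: LeastI_ex)
  moreover have "eval g p (pair x j) \<noteq> Some 0" if "j < y" for j
  proof
    assume "eval g p (pair x j) = Some 0"
    with \<open>halts y\<close> that have "halts j" by (auto simp: halts_def)
    with that y show False by (auto dest: not_less_Least)
  qed
  ultimately show ?thesis
    by (fastforce simp: halts_def)
qed

text \<open>One step of soundness. The clauses refer only to claims about the same string, so one
  oracle extending it can be fixed throughout.\<close>

lemma eval_true_justified:
  assumes "justified_eval S s e x y"
    and S: "\<And>e x y. eval_claim s e x y \<in> S \<Longrightarrow> eval_true s e x y"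
  shows "eval_true s e x y"
  unfolding eval_true_def
proof (intro allI impI)
  fix g assume g: "prefix_of s g"
  have S': "eval g (prog_of e) x = Some y" if "eval_claim s e x y \<in> S" for e x y
    using S[OF that] g by (simp add: eval_true_def)
  consider "e < 5" | "5 \<le> e" by linarith
  then show "eval g (prog_of e) x = Some y"
  proof cases
    case 1
    then consider "e = 0" | "e = 1" | "e = 2" | "e = 3" | "e = 4" by linarith
    then show ?thesis
      using assms(1) g
      by cases (auto simp: justified_eval_def prog_of_basic prog_of_basic(2)[unfolded One_nat_def] prefix_of_def)
  next
    case 2
    define m where "m = (e - 5) div 4"
    have J: "if (e - 5) mod 4 = 0
      then eval_claim s (pfst m) x (pfst y) \<in> S \<and> eval_claim s (psnd m) x (psnd y) \<in> S
      else if (e - 5) mod 4 = 1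
      then \<exists>z. eval_claim s (psnd m) x z \<in> S \<and> eval_claim s (pfst m) z y \<in> S
      else if (e - 5) mod 4 = 2 then
        if psnd x = 0 then eval_claim s (pfst m) (pfst x) y \<in> S
        else \<exists>v. eval_claim s e (pair (pfst x) (psnd x - 1)) v \<in> S \<and>
                 eval_claim s (psnd m) (pair (pfst x) (pair (psnd x - 1) v)) y \<in> S
      else eval_claim s m (pair x y) 0 \<in> S \<and>
           (\<forall>j<y. \<exists>v. eval_claim s m (pair x j) v \<in> S \<and> 0 < v)"
      using assms(1) 2 unfolding justified_eval_def Let_def m_def by simp
    consider "(e - 5) mod 4 = 0" | "(e - 5) mod 4 = 1" | "(e - 5) mod 4 = 2" | "(e - 5) mod 4 = 3"
      by linarith
    then show ?thesis
    proof cases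
      case r: 1
      then have "prog_of e = Paired (prog_of (pfst m)) (prog_of (psnd m))"
        using 2 by (simp add: prog_of_compound m_def Let_def)
      then show ?thesis using J r by (auto dest!: S')
    next
      case r: 2
      then have "prog_of e = Comp (prog_of (pfst m)) (prog_of (psnd m))"
        using 2 by (simp add: prog_of_compound m_def Let_def)
      then show ?thesis using J r by (auto dest!: S')
    next
      case r: 3
      then have e: "prog_of e = PrimRec (prog_of (pfst m)) (prog_of (psnd m))"
        using 2 by (simp add: prog_of_compound m_def Let_def)
      show ?thesis
      proof (cases "psnd x")
        case 0
        then show ?thesis using J r by (auto simp: e split: prod.splits dest!: S')
      next
        case (Suc k)
        then obtain v where "eval_claim s e (pair (pfst x) k) v \<in> S"
          "eval_claim s (psnd m) (pair (pfst x) (pair k v)) y \<in> S"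
          using J r by auto
        from this[THEN S'] show ?thesis using Suc by (auto simp: e split: prod.splits)
      qed
    next
      case r: 4
      then have e: "prog_of e = Mu (prog_of m)"
        using 2 by (simp add: prog_of_compound m_def Let_def)
      have J0: "eval_claim s m (pair x y) 0 \<in> S"
        and J1: "\<And>j. j < y \<Longrightarrow> \<exists>v. eval_claim s m (pair x j) v \<in> S \<and> 0 < v"
        using J r by simp_all
      show ?thesis
        unfolding e using S'[OF J0] J1 S' by (intro eval_MuI) blast+
    qed
  qed
qed

text \<open>Induction on the program number, since components have smaller numbers. Each step uses
  finitely many premises, so their eventual bounds combine. The clause for \<open>PrimRec\<close>
  refers back to the same program, which calls for an inner induction on the recursion
  depth.\<close>

lemma eventually_derivable:
  assumes "eval g (prog_of e) x = Some y"
  shows "\<forall>\<^sub>F n in sequentially. derivable (eval_claim (prefix_code g n) e x y)"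
  using assms
proof (induction e arbitrary: x y rule: less_induct)
  case (less e)
  consider "e < 4" | "e = 4" | "5 \<le> e" by linarith
  then show ?case
  proof cases
    case 1
    then consider "e = 0" | "e = 1" | "e = 2" | "e = 3" by linarith
    then have "justified {} (eval_claim (prefix_code g n) e x y)" for n
      using less.prems by cases (auto simp: justified_eval_def prog_of_basic prog_of_basic(2)[unfolded One_nat_def])
    then show ?thesis by (intro always_eventually allI) (rule derivableI, auto)
  next
    case 2
    have "derivable (eval_claim (prefix_code g n) e x y)" if "x < n" for n
      by (rule derivableI[of "{}"])
              (use less.prems 2 that in \<open>auto simp: justified_eval_def prog_of_basic\<close>)
    then show ?thesis
      using eventually_gt_at_top[of x] by (rule eventually_mono[rotated])
  next
    case 3
    define m where "m = (e - 5) div 4"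
    have m: "m < e" "pfst m < e" "psnd m < e"
      using 3 prod_decode_div_less[of e] by (auto simp: m_def)
    consider "(e - 5) mod 4 = 0" | "(e - 5) mod 4 = 1" | "(e - 5) mod 4 = 2" | "(e - 5) mod 4 = 3"
      by linarith
    then show ?thesis
    proof cases
      case r: 1
      then have "prog_of e = Paired (prog_of (pfst m)) (prog_of (psnd m))"
        using 3 by (simp add: prog_of_compound m_def Let_def)
      then have "eval g (prog_of (pfst m)) x = Some (pfst y)" "eval g (prog_of (psnd m)) x = Some (psnd y)"
        using less.prems by (auto simp: bind_eq_Some_conv)
      from less.IH[OF m(2) this(1)] less.IH[OF m(3) this(2)] show ?thesis
      proof eventually_elim
        case (elim n)
        show ?case
          by (rule derivableI[of "{eval_claim (prefix_code g n) (pfst m) x (pfst y),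
              eval_claim (prefix_code g n) (psnd m) x (psnd y)}"])
            (use elim 3 r in \<open>auto simp: justified_eval_def Let_def m_def\<close>)
      qed
    next
      case r: 2
      then have "prog_of e = Comp (prog_of (pfst m)) (prog_of (psnd m))"
        using 3 by (simp add: prog_of_compound m_def Let_def)
      then obtain z where "eval g (prog_of (psnd m)) x = Some z" "eval g (prog_of (pfst m)) z = Some y"
        using less.prems by (auto simp: bind_eq_Some_conv)
      from less.IH[OF m(3) this(1)] less.IH[OF m(2) this(2)] show ?thesis
      proof eventually_elim
        case (elim n)
        show ?case
          by (rule derivableI[of "{eval_claim (prefix_code g n) (psnd m) x z,
              eval_claim (prefix_code g n) (pfst m) z y}"])
            (use elim 3 r in \<open>auto simp: justified_eval_def Let_def m_def\<close>)
      qed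
    next
      case r: 3
      then have e: "prog_of e = PrimRec (prog_of (pfst m)) (prog_of (psnd m))"
        using 3 by (simp add: prog_of_compound m_def Let_def)
      have "\<forall>\<^sub>F n in sequentially. derivable (eval_claim (prefix_code g n) e (pair u k) y)"
        if "eval g (prog_of e) (pair u k) = Some y" for u k y
        using that
      proof (induction k arbitrary: y)
        case 0
        then have "eval g (prog_of (pfst m)) u = Some y" by (simp add: e)
        from less.IH[OF m(2) this] show ?case
        proof eventually_elim
          case (elim n)
          show ?case
            by (rule derivableI[of "{eval_claim (prefix_code g n) (pfst m) u y}"])
              (use elim 3 r in \<open>auto simp: justified_eval_def Let_def m_def\<close>)
        qed
      next
        case (Suc k)
        then obtain v where v: "eval g (prog_of e) (pair u k) = Some v"
          and "eval g (prog_of (psnd m)) (pair u (pair k v)) = Some y"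
          by (auto simp: e bind_eq_Some_conv)
        from Suc.IH[OF v] less.IH[OF m(3) this(2)] show ?case
        proof eventually_elim
          case (elim n)
          show ?case
            by (rule derivableI[of "{eval_claim (prefix_code g n) e (pair u k) v,
                eval_claim (prefix_code g n) (psnd m) (pair u (pair k v)) y}"])
              (use elim 3 r in \<open>auto simp: justified_eval_def Let_def m_def\<close>)
        qed
      qed
      from this[of "pfst x" "psnd x" y] less.prems show ?thesis by simp
    next
      case r: 4
      then have e: "prog_of e = Mu (prog_of m)"
        using 3 by (simp add: prog_of_compound m_def Let_def)
      from eval_MuD[OF less.prems[unfolded e]] obtain v
        where 0: "eval g (prog_of m) (pair x y) = Some 0"
          and v: "\<And>j. j < y \<Longrightarrow> eval g (prog_of m) (pair x j) = Some (v j) \<and> 0 < v j"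
        by metis
      have "\<forall>\<^sub>F n in sequentially. \<forall>j\<in>{..<y}. derivable (eval_claim (prefix_code g n) m (pair x j) (v j))"
        using less.IH[OF m(1)] v by (intro eventually_ball_finite) auto
      with less.IH[OF m(1) 0] show ?thesis
      proof eventually_elim
        case (elim n)
        show ?case
          by (rule derivableI[of "insert (eval_claim (prefix_code g n) m (pair x y) 0)
              ((\<lambda>j. eval_claim (prefix_code g n) m (pair x j) (v j)) ` {..<y})"])
            (use elim 3 r v in \<open>auto simp: justified_eval_def Let_def m_def\<close>)
      qed
    qed
  qed
qed

section \<open>Soundness of votes, and the use principle\<close>

definition claim_true :: "(nat \<Rightarrow> nat \<Rightarrow> nat \<Rightarrow> bool) \<Rightarrow> nat \<Rightarrow> bool" where
  "claim_true V c \<longleftrightarrow>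
     (if pfst c = 0
      then eval_true (pfst (psnd c)) (pfst (psnd (psnd c)))
             (pfst (psnd (psnd (psnd c)))) (psnd (psnd (psnd (psnd c))))
      else V (pfst (psnd c)) (pfst (psnd (psnd c))) (psnd (psnd (psnd c))))"

lemma claim_true_claim [simp]:
  "claim_true V (eval_claim s e x y) \<longleftrightarrow> eval_true s e x y"
  "claim_true V (vote_claim N v s) \<longleftrightarrow> V N v s"
  by (simp_all add: claim_true_def eval_claim_def vote_claim_def)

text \<open>Induction along the certificate. Any predicate V closed under the two voting rules may
  serve as the meaning of a vote, because derivable votes form the least such predicate.\<close>

lemma claim_true_derivable:
  assumes "derivable c"
    and V: "\<And>N v s. eval_true s (N div 2) (N div 2) v \<Longrightarrow> V N v s"
      "\<And>N v s. threshold (coord N (len s)) <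
          card {j. j < width (coord N (len s)) \<and> V N v (snoc s j)} \<Longrightarrow> V N v s"
  shows "claim_true V c"
proof -
  have "\<forall>c\<in>set cs. claim_true V c" if "valid cs" for cs
    using that
  proof (induction cs)
    case (Cons c cs)
    then have S: "\<And>d. d \<in> set cs \<Longrightarrow> claim_true V d" and J: "justified (set cs) c"
      by auto
    have "claim_true V c"
    proof (cases "pfst c = 0")
      case True
      have "eval_true s e x y" if "justified_eval (set cs) s e x y" for s e x y
        by (rule eval_true_justified[OF that]) (use S in fastforce)
      then show ?thesis
        using J True by (simp add: justified_def claim_true_def)
    next
      case False
      have "V N v s" if "justified_vote (set cs) N v s" for N v s
      proof (cases "eval_claim s (N div 2) (N div 2) v \<in> set cs")
        case True
        from S[OF this] show ?thesis by (simp add: V(1))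
      next
        case False
        have "card {j. j < width (coord N (len s)) \<and> vote_claim N v (snoc s j) \<in> set cs} \<le>
          card {j. j < width (coord N (len s)) \<and> V N v (snoc s j)}"
          by (intro card_mono) (auto dest!: S)
        with False that show ?thesis
          by (intro V(2)) (auto simp: justified_vote_def)
      qed
      then show ?thesis
        using False J by (auto simp: justified_def claim_true_def)
    qed
    then show ?case using S by simp
  qed simp
  then show ?thesis
    using assms(1) by (auto simp: derivable_def simp del: valid.simps)
qed

lemma derivable_eval_true: "derivable (eval_claim s e x y) \<Longrightarrow> eval_true s e x y"
  using claim_true_derivable[of "eval_claim s e x y" "\<lambda>_ _ _. True"] by simp

lemma derivable_vote_eval:
  "derivable (eval_claim s (N div 2) (N div 2) v) \<Longrightarrow> derivable (vote_claim N v s)"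
  by (rule derivableI[of "{eval_claim s (N div 2) (N div 2) v}"]) (auto simp: justified_vote_def)

lemma derivable_vote_majority:
  assumes "threshold (coord N (len s)) <
    card {j. j < width (coord N (len s)) \<and> derivable (vote_claim N v (snoc s j))}"
  shows "derivable (vote_claim N v s)"
proof -
  let ?J = "{j. j < width (coord N (len s)) \<and> derivable (vote_claim N v (snoc s j))}"
  let ?T = "(\<lambda>j. vote_claim N v (snoc s j)) ` ?J"
  have "card ?J \<le> card {j. j < width (coord N (len s)) \<and> vote_claim N v (snoc s j) \<in> ?T}"
    by (intro card_mono) auto
  with assms have "justified ?T (vote_claim N v s)"
    unfolding justified_vote_claim justified_vote_def by linarith
  then show ?thesis
    by (rule derivableI) auto
qed

text \<open>A certificate for a prefix of the oracle is sound for every oracle with that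
  prefix.\<close>

lemma eval_use:
  assumes "eval g (prog_of e) x = Some y"
  shows "\<exists>n. \<forall>h. (\<forall>i<n. h i = g i) \<longrightarrow> eval h (prog_of e) x = Some y"
proof -
  obtain n where "derivable (eval_claim (prefix_code g n) e x y)"
    using eventually_derivable[OF assms] by (auto simp: eventually_sequentially)
  from derivable_eval_true[OF this] show ?thesis
    by (intro exI[of _ n]) (auto simp: eval_true_def prefix_of_def)
qed

text \<open>The condition \<open>w \<noteq> 0\<close> excludes the empty list, whose
  \<open>chd\<close> is 0 by default and would pass for the claim coded by 0.\<close>

definition certifies :: "nat \<Rightarrow> nat \<Rightarrow> bool" where
  "certifies w c \<longleftrightarrow> w \<noteq> 0 \<and> valid (list_decode w) \<and> chd w = c"

lemma derivable_iff_certifies: "derivable c \<longleftrightarrow> (\<exists>w. certifies w c)"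
proof
  assume "derivable c"
  then obtain cs where "valid (c # cs)" by (auto simp: derivable_def)
  then show "\<exists>w. certifies w c"
    by (intro exI[of _ "list_encode (c # cs)"]) (simp add: certifies_def)
next
  assume "\<exists>w. certifies w c"
  then obtain w where w: "w \<noteq> 0" "valid (list_decode w)" "chd w = c"
    by (auto simp: certifies_def)
  then have "c \<in> set (list_decode w)"
    by (metis hd_in_set hd_list_decode list_decode_eq_Nil)
  with w show "derivable c" by (auto intro: derivable_mem)
qed

lemma decidable_certifies [computable_intros]:
  assumes "computable_functional F" "computable_functional G"
  shows "decidable (\<lambda>g x. certifies (F g x) (G g x))"
  unfolding certifies_def by (intro computable_intros assms)

text \<open>A failure of the condition is witnessed by a computation using a finite part of the oracle,
  hence by a certificate, which is found among the numbers below the length of a longer part.\<close>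
lemma Pi01_all:
  assumes "decidable P"
  shows "Pi01 {f. \<forall>n. P f n}"
proof -
  obtain e where e: "\<And>g x. eval g (prog_of e) x = Some (of_bool (P g x))"
    using computable_functional_index[OF assms] by blast
  define bad where "bad z w s n \<longleftrightarrow>
     certifies w (eval_claim s e n 0) \<and> len s \<le> len z \<and> (\<forall>i<len s. entry s i = lnth (list_decode z) i)"
    for z w s n
  define R where "R \<sigma> \<longleftrightarrow> (\<forall>w<length \<sigma>. \<forall>s<length \<sigma>. \<forall>n<length \<sigma>. \<not> bad (list_encode \<sigma>) w s n)"
    for \<sigma>
  have "decidable (\<lambda>g z. \<forall>w<len z. \<forall>s<len z. \<forall>n<len z. \<not> bad z w s n)"
    unfolding bad_def eval_claim_def by (intro computable_intros)
  from computable_functional_index[OF this] obtain d where d: "\<And>g z. eval g (prog_of d) z =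
      Some (of_bool (\<forall>w<len z. \<forall>s<len z. \<forall>n<len z. \<not> bad z w s n))"
    by blast
  then have "computes d (\<lambda>\<sigma>. of_bool (R \<sigma>))"
    by (simp add: computes_def R_def)
  moreover have "{f. \<forall>n. P f n} = {f. \<forall>n. R (initseg f n)}"
  proof (intro Collect_cong iffI allI)
    fix f m assume P: "\<forall>n. P f n"
    show "R (initseg f m)"
      unfolding R_def
    proof (intro allI impI notI)
      fix w s n assume bad: "bad (list_encode (initseg f m)) w s n"
      then have "eval_true s e n 0"
        using derivable_eval_true derivable_iff_certifies unfolding bad_def by blast
      moreover have "prefix_of s f"
        using bad by (auto simp: bad_def prefix_of_def)
      ultimately show False
        using P e[of f n] by (simp add: eval_true_def)
    qed
  next
    fix f n assume R: "\<forall>n. R (initseg f n)"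
    show "P f n"
    proof (rule ccontr)
      assume "\<not> P f n"
      then have "eval f (prog_of e) n = Some 0" by (simp add: e)
      from eventually_derivable[OF this] obtain k
        where "derivable (eval_claim (prefix_code f k) e n 0)"
        by (auto simp: eventually_sequentially)
      then obtain w where w: "certifies w (eval_claim (prefix_code f k) e n 0)"
        using derivable_iff_certifies by blast
      define m where "m = Suc (w + prefix_code f k + n + k)"
      have "bad (list_encode (initseg f m)) w (prefix_code f k) n"
        using w by (auto simp: bad_def m_def)
      moreover have "w < m" "prefix_code f k < m" "n < m" by (auto simp: m_def)
      ultimately show False
        using R[rule_format, of m] by (auto simp: R_def)
    qed
  qed
  ultimately show ?thesis
    unfolding Pi01_def by blast
qed

section \<open>Independent classes\<close>

text \<open>The strings \<open>low_string N\<close> are the choices of values at the coordinates below \<open>N\<close> of the problem that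
  requirement \<open>N\<close> uses as oracle. There are at most \<open>threshold N\<close> of them, and each kills at most one
  value.\<close>

definition low_string :: "nat \<Rightarrow> nat \<Rightarrow> bool" where
  "low_string N s \<longleftrightarrow> len s = Suc N div 2 \<and> (\<forall>i<len s. entry s i < width (coord N i))"

text \<open>A certified value is below its certificate (\<open>certifies_vote_bound\<close>), so
  bounding v' by w loses nothing and keeps the condition decidable.\<close>

definition first_cert :: "nat \<Rightarrow> nat \<Rightarrow> nat \<Rightarrow> nat \<Rightarrow> bool" where
  "first_cert N s w v \<longleftrightarrow> low_string N s \<and> certifies w (vote_claim N v s) \<and>
     (\<forall>w'<w. \<forall>v'<w. \<not> certifies w' (vote_claim N v' s))"

text \<open>Stages of an enumeration: avoiding the killed values becomes a universal condition over
  t with a decidable matrix.\<close>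

definition killed_at :: "nat \<Rightarrow> nat \<Rightarrow> nat \<Rightarrow> bool" where
  "killed_at t N v \<longleftrightarrow> (\<exists>w<t. \<exists>s<t. first_cert N s w v)"

definition killed :: "nat \<Rightarrow> nat set" where
  "killed N = {v. \<exists>t. killed_at t N v}"

definition solutions :: "nat \<Rightarrow> (nat \<Rightarrow> nat) set" where
  "solutions l = {f. \<forall>i. f i < width (2 * i + l) \<and> f i \<notin> killed (2 * i + l)}"

definition solvable :: "nat \<Rightarrow> nat \<Rightarrow> bool" where
  "solvable l s \<longleftrightarrow>
     (\<forall>i<len s. entry s i < width (2 * i + l) \<and> entry s i \<notin> killed (2 * i + l))"

lemma decidable_killed_at [computable_intros]:
  assumes "computable_functional T" "computable_functional N" "computable_functional V"
  shows "decidable (\<lambda>g x. killed_at (T g x) (N g x) (V g x))"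
proof -
  have "decidable (\<lambda>g z. killed_at (pfst z) (pfst (psnd z)) (psnd (psnd z)))"
    unfolding killed_at_def first_cert_def low_string_def vote_claim_def
    by (intro computable_intros)
  from computable_comp[OF this computable_pair[OF assms(1) computable_pair[OF assms(2,3)]]]
  show ?thesis by simp
qed

section \<open>Counting low strings and killed values\<close>

lemma threshold_ge_2: "2 \<le> threshold N"
  unfolding threshold_def using power_increasing[of 1 "4 ^ N" "2::nat"] by simp

lemma threshold_mono: "M \<le> N \<Longrightarrow> threshold M \<le> threshold N"
  unfolding threshold_def by (intro power_increasing) auto

lemma width_mono: "M \<le> N \<Longrightarrow> width M \<le> width N"
  unfolding width_def by (intro power_mono threshold_mono) auto

lemma threshold_less_width: "threshold N < width N"
  unfolding width_def using threshold_ge_2[of N] power_strict_increasing[of 1 3 "threshold N"] by simp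

text \<open>The counting behind \<open>diagonalization\<close>: at coordinate N', the killed values
  together with \<open>threshold N'\<close> further ones for each of the \<open>width N\<close>
  possible outputs do not exhaust the values.\<close>

lemma width_bound:
  assumes "N < N'"
  shows "threshold N' + width N * threshold N' < width N'"
proof -
  let ?t = "threshold N" and ?T = "threshold N'"
  have t: "2 \<le> ?t" "2 \<le> ?T" by (rule threshold_ge_2)+
  have "?t ^ 4 = threshold (Suc N)"
    by (simp add: threshold_def power_mult[symmetric] mult.commute)
  also have "\<dots> \<le> ?T" using assms by (intro threshold_mono) simp
  finally have "?t ^ 4 \<le> ?T" .
  moreover have "?t ^ 3 + 1 \<le> ?t ^ 4"
  proof -
    have "?t ^ 3 + 1 \<le> ?t ^ 3 * 2" using t(1) by simp
    also have "\<dots> \<le> ?t ^ 3 * ?t" using t(1) by (rule mult_left_mono) simp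
    finally show ?thesis by (simp add: power3_eq_cube power4_eq_xxxx)
  qed
  ultimately have "(?t ^ 3 + 1) * ?T \<le> ?T * ?T"
    by (intro mult_right_mono) auto
  also have "\<dots> < ?T * ?T * ?T"
    using t(2) by simp
  finally show ?thesis by (simp add: width_def power3_eq_cube algebra_simps)
qed

lemma ex_snoc: "0 < len s \<Longrightarrow> \<exists>s' j. s = snoc s' j"
  by (cases s) (auto simp: snoc_def, metis pair_decode)

lemma finite_card_strings:
  "finite {s. len s = m \<and> (\<forall>i<m. entry s i < h i)} \<and>
   card {s. len s = m \<and> (\<forall>i<m. entry s i < h i)} \<le> (\<Prod>i<m. h i)"
proof (induction m)
  case 0
  have "{s. len s = 0 \<and> (\<forall>i<0. entry s i < h i)} = {0}"
    by (auto simp: list_decode_eq_Nil)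
  then show ?case by simp
next
  case (Suc m)
  let ?A = "\<lambda>m. {s. len s = m \<and> (\<forall>i<m. entry s i < h i)}"
  have sub: "?A (Suc m) \<subseteq> (\<lambda>(s, j). snoc s j) ` (?A m \<times> {..<h m})"
  proof
    fix s assume s: "s \<in> ?A (Suc m)"
    then obtain s' j where s': "s = snoc s' j" using ex_snoc[of s] by auto
    with s have "s' \<in> ?A m" "j < h m"
      by (force simp: less_Suc_eq)+
    then show "s \<in> (\<lambda>(s, j). snoc s j) ` (?A m \<times> {..<h m})"
      using s' by auto
  qed
  have fin: "finite (?A m \<times> {..<h m})" using Suc by simp
  have "card (?A (Suc m)) \<le> card (?A m \<times> {..<h m})"
    using sub fin by (meson card_image_le card_mono finite_imageI le_trans)
  also have "\<dots> \<le> (\<Prod>i<Suc m. h i)"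
    using Suc by (simp add: card_cartesian_product)
  finally show ?case using finite_subset[OF sub finite_imageI[OF fin]] by (rule conjI[rotated])
qed

text \<open>A geometric sum of ratio 16. Of the factor 12, 3 comes from the exponent in
  \<open>width\<close> and 4 from passing from 4 ^ N to 4 ^ (N + 1).\<close>

lemma sum_power4: "12 * (\<Sum>i<m. 4 ^ (2 * i + l)) \<le> (4 :: nat) ^ (2 * m + l)"
proof (induction m)
  case (Suc m)
  have "(4 :: nat) ^ (2 * Suc m + l) = 16 * 4 ^ (2 * m + l)"
    by (simp add: power_add)
  moreover have "12 * a \<le> b \<Longrightarrow> c = 16 * b \<Longrightarrow> 12 * (a + b) \<le> c" for a b c :: nat
    by simp
  ultimately show ?case
    using Suc unfolding sum.lessThan_Suc by blast
qed simp

lemma finite_card_low_strings: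
  "finite {s. low_string N s} \<and> card {s. low_string N s} \<le> threshold N"
proof -
  let ?m = "Suc N div 2"
  have "{s. low_string N s} = {s. len s = ?m \<and> (\<forall>i<?m. entry s i < width (coord N i))}"
    by (auto simp: low_string_def)
  moreover have "(\<Prod>i<?m. width (coord N i)) \<le> threshold N"
  proof -
    \<comment> \<open>In both parities, the first coordinate beyond a low string has number N +
      1.\<close>
    have "2 * ?m + (1 - N mod 2) = Suc N" by presburger
    then have "12 * (\<Sum>i<?m. 4 ^ coord N i) \<le> (4 :: nat) ^ Suc N"
      using sum_power4[where m = ?m and l = "1 - N mod 2"] by simp
    then have "(\<Sum>i<?m. 3 * 4 ^ coord N i) \<le> (4 :: nat) ^ N"
      by (simp add: sum_distrib_left[symmetric])
    then have "(2 :: nat) ^ (\<Sum>i<?m. 3 * 4 ^ coord N i) \<le> 2 ^ 4 ^ N"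
      by (intro power_increasing) auto
    then show ?thesis
      by (simp add: width_def threshold_def power_mult[symmetric] power_sum mult.commute)
  qed
  ultimately show ?thesis
    using finite_card_strings[of ?m "\<lambda>i. width (coord N i)"] by simp
qed

lemma vote_claim_inject:
  "vote_claim N v s = vote_claim N v' s \<longleftrightarrow> v = v'"
  by (simp add: vote_claim_def)

lemma certifies_vote_bound:
  assumes "certifies w (vote_claim N v s)" shows "v < w"
proof -
  have "v \<le> vote_claim N v s"
    unfolding vote_claim_def by (meson le_prod_encode_1 le_prod_encode_2 le_trans)
  also have "\<dots> = chd w" using assms by (simp add: certifies_def)
  also have "\<dots> \<le> w - 1"
    using le_prod_encode_1[of "chd w" "psnd (w - 1)"] by simp
  finally have "v \<le> w - 1" .
  moreover have "w \<noteq> 0" using assms by (simp add: certifies_def)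
  ultimately show ?thesis by linarith
qed

lemma first_cert_unique:
  assumes "first_cert N s w v" "first_cert N s w' v'"
  shows "v = v'"
proof -
  have "\<not> a < b" if "first_cert N s a u" "first_cert N s b u'" for a b u u'
    using that certifies_vote_bound[of a N u s] by (meson first_cert_def less_trans)
  then have "w = w'" using assms by (meson linorder_neqE_nat)
  then show ?thesis
    using assms by (auto simp: first_cert_def certifies_def vote_claim_inject)
qed

lemma killed_iff: "v \<in> killed N \<longleftrightarrow> (\<exists>s w. first_cert N s w v)"
proof
  assume "\<exists>s w. first_cert N s w v"
  then obtain s w where "first_cert N s w v" by blast
  then have "killed_at (Suc (s + w)) N v"
    unfolding killed_at_def by (intro exI[of _ w] exI[of _ s] conjI) simp_all
  then show "v \<in> killed N" by (auto simp: killed_def)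
qed (auto simp: killed_def killed_at_def)

text \<open>Sending each killed value to a low string that kills it is injective, as a string kills
  at most one value.\<close>

lemma finite_card_killed: "finite (killed N) \<and> card (killed N) \<le> threshold N"
proof -
  define f where "f v = (SOME s. \<exists>w. first_cert N s w v)" for v
  have f: "\<exists>w. first_cert N (f v) w v" if "v \<in> killed N" for v
    using that unfolding killed_iff f_def by (rule someI_ex)
  then have inj: "inj_on f (killed N)"
    by (intro inj_onI) (metis first_cert_unique)
  have sub: "f ` killed N \<subseteq> {s. low_string N s}"
    using f by (auto simp: first_cert_def)
  show ?thesis
    using finite_card_low_strings[of N] card_inj_on_le[OF inj sub] inj_on_finite[OF inj sub] by auto
qed

lemma ex_not_killed:
  assumes "threshold N < card J"
  shows "\<exists>j\<in>J. j \<notin> killed N"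
proof (rule ccontr)
  assume "\<not> ?thesis"
  then have "card J \<le> card (killed N)"
    using finite_card_killed by (intro card_mono) auto
  with assms finite_card_killed[of N] show False by simp
qed

section \<open>Solvable strings and diagonalization\<close>

lemma ex_solution:
  assumes "solvable l s"
  shows "\<exists>f\<in>solutions l. prefix_of s f"
proof -
  have "\<exists>j. j < width N \<and> j \<notin> killed N" for N
    using ex_not_killed[of N "{..<width N}"] threshold_less_width[of N] by auto
  then obtain c where c: "\<And>N. c N < width N \<and> c N \<notin> killed N" by metis
  show ?thesis
    by (rule bexI[of _ "\<lambda>i. if i < len s then entry s i else c (2 * i + l)"])
      (use assms c in \<open>auto simp: solutions_def solvable_def prefix_of_def\<close>)
qed

lemma solvable_snoc:
  "solvable l (snoc s j) \<longleftrightarrow>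
     solvable l s \<and> j < width (2 * len s + l) \<and> j \<notin> killed (2 * len s + l)"
  by (auto simp: solvable_def less_Suc_eq)

text \<open>A vote is interpreted as: if s is solvable, some solution through s yields v. This
  respects the majority rule, since among more than threshold many voters one is not killed and
  keeps the string solvable.\<close>

lemma derivable_vote_solution:
  assumes "derivable (vote_claim N v s)" "solvable (1 - N mod 2) s"
  shows "\<exists>f\<in>solutions (1 - N mod 2). prefix_of s f \<and> eval f (prog_of (N div 2)) (N div 2) = Some v"
proof -
  define V where "V N v s \<longleftrightarrow> (solvable (1 - N mod 2) s \<longrightarrow> (\<exists>f\<in>solutions (1 - N mod 2).
      prefix_of s f \<and> eval f (prog_of (N div 2)) (N div 2) = Some v))" for N v s
  have "claim_true V (vote_claim N v s)"
  proof (rule claim_true_derivable[OF assms(1)])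
    fix N v s assume "eval_true s (N div 2) (N div 2) v"
    then show "V N v s"
      using ex_solution[of "1 - N mod 2" s] unfolding V_def eval_true_def by blast
  next
    fix N v s
    assume "threshold (coord N (len s)) < card {j. j < width (coord N (len s)) \<and> V N v (snoc s j)}"
    from ex_not_killed[OF this] obtain j where j: "j < width (coord N (len s))"
      "V N v (snoc s j)" "j \<notin> killed (coord N (len s))" by auto
    show "V N v s"
      unfolding V_def
    proof
      assume "solvable (1 - N mod 2) s"
      with j(1,3) have "solvable (1 - N mod 2) (snoc s j)" by (simp add: solvable_snoc)
      with j(2) obtain f where f: "f \<in> solutions (1 - N mod 2)" "prefix_of (snoc s j) f"
        "eval f (prog_of (N div 2)) (N div 2) = Some v" unfolding V_def by blast
      from f(2) have "prefix_of s f"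
        by (auto simp: prefix_of_def dest: less_SucI split: if_splits)
      with f show "\<exists>f\<in>solutions (1 - N mod 2).
          prefix_of s f \<and> eval f (prog_of (N div 2)) (N div 2) = Some v" by blast
    qed
  qed
  then show ?thesis using assms(2) by (simp add: V_def)
qed

lemma ex_path:
  assumes "Q 0" "\<And>s. Q s \<Longrightarrow> \<exists>j. Q (snoc s j)"
  shows "\<exists>f. \<forall>n. Q (prefix_code f n)"
proof -
  define p where "p = rec_nat 0 (\<lambda>_ s. snoc s (SOME j. Q (snoc s j)))"
  define f where "f n = (SOME j. Q (snoc (p n) j))" for n
  have "prefix_code f n = p n" for n
    by (induction n) (simp_all add: p_def f_def)
  moreover have "Q (p n)" for n
  proof (induction n)
    case (Suc n)
    from someI_ex[OF assms(2)[OF Suc]] show ?case by (simp add: p_def)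
  qed (simp add: p_def assms(1))
  ultimately show ?thesis by metis
qed

text \<open>If a solvable low string has a vote, its least certificate kills a value that a solution
  through this string produces. Otherwise a solution is built entry by entry so that no value below
  \<open>width N\<close> ever gets a vote; producing such a value would give a vote at some
  prefix.\<close>

lemma diagonalization:
  "\<exists>f\<in>solutions (1 - N mod 2). \<forall>v. eval f (prog_of (N div 2)) (N div 2) = Some v \<longrightarrow>
      v < width N \<longrightarrow> v \<in> killed N"
proof (cases "\<exists>s v. low_string N s \<and> solvable (1 - N mod 2) s \<and> derivable (vote_claim N v s)")
  case True
  then obtain s where s: "low_string N s" "solvable (1 - N mod 2) s"
    and ex: "\<exists>w. \<exists>v. certifies w (vote_claim N v s)"
    unfolding derivable_iff_certifies by blast
  define w where "w = (LEAST w. \<exists>v. certifies w (vote_claim N v s))"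
  obtain v where w: "certifies w (vote_claim N v s)"
    using LeastI_ex[OF ex] unfolding w_def by blast
  have "\<not> certifies w' (vote_claim N v' s)" if "w' < w" for w' v'
    using not_less_Least[of w'] that unfolding w_def by blast
  with s w have "v \<in> killed N"
    unfolding killed_iff first_cert_def by blast
  moreover have "derivable (vote_claim N v s)"
    using w unfolding derivable_iff_certifies by blast
  from derivable_vote_solution[OF this s(2)] obtain f
    where "f \<in> solutions (1 - N mod 2)" "eval f (prog_of (N div 2)) (N div 2) = Some v" by blast
  ultimately show ?thesis by (intro bexI[of _ f]) simp_all
next
  case False
  define Q where "Q s \<longleftrightarrow> solvable (1 - N mod 2) s \<and>
     (Suc N div 2 \<le> len s \<longrightarrow> (\<forall>v<width N. \<not> derivable (vote_claim N v s)))" for s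
  \<comment> \<open>Strings shorter than low strings only have to be solvable; at the length of low
    strings the case assumption excludes votes.\<close>
  have low: "Q s" if "solvable (1 - N mod 2) s" "len s \<le> Suc N div 2" for s
    using False that by (auto simp: Q_def low_string_def solvable_def)
  have "\<exists>j. Q (snoc s j)" if "Q s" for s
  proof (cases "len s < Suc N div 2")
    case True
    obtain j where "j < width (coord N (len s))" "j \<notin> killed (coord N (len s))"
      using ex_not_killed[of _ "{..<width (coord N (len s))}"] threshold_less_width by force
    then show ?thesis
      using that True low[of "snoc s j"] by (auto simp: Q_def solvable_snoc)
  next
    case False
    let ?N = "coord N (len s)"
    let ?J = "\<lambda>v. {j. j < width ?N \<and> derivable (vote_claim N v (snoc s j))}"
    have "N < ?N" using False by presburger
    \<comment> \<open>More than threshold many entries with a vote for v would give s itself one,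
      against \<open>Q s\<close>. Summing over v, \<open>width_bound\<close> leaves an entry that is
      neither killed nor carries a vote.\<close>
    have J: "card (?J v) \<le> threshold ?N" if "v < width N" for v
      using \<open>Q s\<close> False derivable_vote_majority[where N = N and s = s and v = v] that by (force simp: Q_def)
    have "card (killed ?N \<union> (\<Union>v<width N. ?J v)) \<le> card (killed ?N) + card (\<Union>v<width N. ?J v)"
      by (rule card_Un_le)
    also have "\<dots> \<le> threshold ?N + (\<Sum>v<width N. card (?J v))"
      using finite_card_killed by (intro add_mono card_UN_le) auto
    also have "(\<Sum>v<width N. card (?J v)) \<le> width N * threshold ?N"
      using sum_bounded_above[of "{..<width N}" "\<lambda>v. card (?J v)" "threshold ?N"] J by simp
    also have "threshold ?N + width N * threshold ?N < width ?N"
      using \<open>N < ?N\<close> by (rule width_bound)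
    finally have "\<not> {..<width ?N} \<subseteq> killed ?N \<union> (\<Union>v<width N. ?J v)"
      using card_mono[of "killed ?N \<union> (\<Union>v<width N. ?J v)" "{..<width ?N}"] finite_card_killed
      by auto
    then obtain j where "j < width ?N" "j \<notin> killed ?N"
      "\<And>v. v < width N \<Longrightarrow> \<not> derivable (vote_claim N v (snoc s j))" by auto
    then show ?thesis
      using that by (auto simp: Q_def solvable_snoc)
  qed
  moreover have "Q 0" by (rule low) (auto simp: solvable_def)
  ultimately obtain f where f: "\<And>n. Q (prefix_code f n)"
    using ex_path[of Q] by blast
  have "f \<in> solutions (1 - N mod 2)"
    unfolding solutions_def
  proof (intro CollectI allI)
    fix i
    from f[of "Suc i"] show "f i < width (coord N i) \<and> f i \<notin> killed (coord N i)"
      by (simp add: Q_def solvable_snoc)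
  qed
  moreover have "\<not> v < width N" if "eval f (prog_of (N div 2)) (N div 2) = Some v" for v
  proof
    assume "v < width N"
    from eventually_derivable[OF that] obtain n where
      n: "\<And>k. n \<le> k \<Longrightarrow> derivable (eval_claim (prefix_code f k) (N div 2) (N div 2) v)"
      by (auto simp: eventually_sequentially)
    \<comment> \<open>The prefix has to be long enough for the certificate and also at least as long
      as a low string, where \<open>Q\<close> excludes votes.\<close>
    let ?k = "max n (Suc N div 2)"
    have "derivable (vote_claim N v (prefix_code f ?k))"
      by (intro derivable_vote_eval n) simp
    with f[of ?k] \<open>v < width N\<close> show False by (simp add: Q_def)
  qed
  ultimately show ?thesis by blast
qed

section \<open>The two classes\<close>

text \<open>In a row \<open>r\<close> the label is \<open>r 0\<close>, and \<open>r (mark n j) = 1\<close> says that \<open>j\<close> is a value at coordinate \<open>n\<close>;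
  several values may be marked, all of which have to be admissible. Marks outside the coordinates \<open>I\<close>
  are forbidden, which makes the rows of a member of \<open>P_class\<close> finite.\<close>

abbreviation mark :: "nat \<Rightarrow> nat \<Rightarrow> nat" where
  "mark n j \<equiv> Suc (pair n j)"

definition row_ok :: "nat set \<Rightarrow> (nat \<Rightarrow> nat) \<Rightarrow> bool" where
  "row_ok I r \<longleftrightarrow> (\<forall>a. r a < 2) \<and> (\<forall>n\<in>I. \<exists>j<width (2 * n + r 0). r (mark n j) = 1) \<and>
     (\<forall>n j. r (mark n j) = 1 \<longrightarrow> n \<in> I \<and> j < width (2 * n + r 0) \<and> j \<notin> killed (2 * n + r 0))"

definition row :: "(nat \<Rightarrow> nat) \<Rightarrow> nat \<Rightarrow> nat \<Rightarrow> nat" where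
  "row x i a = x (pair i a)"

definition Q_class :: "(nat \<Rightarrow> nat) set" where
  "Q_class = {q. row_ok UNIV q}"

definition P_class :: "(nat \<Rightarrow> nat) set" where
  "P_class = {x. \<forall>i. row_ok {..i} (row x i)}"

lemma row_ok_less_2: "row_ok I r \<Longrightarrow> r a < 2"
  by (simp add: row_ok_def)

lemma row_ok_ex: "row_ok I r \<Longrightarrow> n \<in> I \<Longrightarrow> \<exists>j. r (mark n j) = 1"
  by (auto simp: row_ok_def)

lemma row_ok_mark:
  "row_ok I r \<Longrightarrow> r (mark n j) = 1 \<Longrightarrow>
     n \<in> I \<and> j < width (2 * n + r 0) \<and> j \<notin> killed (2 * n + r 0)"
  by (simp add: row_ok_def)

lemma P_class_row: "x \<in> P_class \<Longrightarrow> row_ok {..i} (row x i)"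
  by (simp add: P_class_def)

lemma Q_class_subset: "Q_class \<subseteq> cantor_space"
  by (auto simp: Q_class_def cantor_space_def row_ok_def)

lemma P_class_less_2: "x \<in> P_class \<Longrightarrow> x z < 2"
  using row_ok_less_2[OF P_class_row[of x "pfst z"], of "psnd z"] by (simp add: row_def)

lemma P_class_subset: "P_class \<subseteq> cantor_space"
  by (auto simp: cantor_space_def P_class_less_2)

text \<open>The form required by \<open>Pi01_all\<close>: the existential quantifier is bounded by
  the width and non-membership in \<open>killed\<close> is spread over stages, so all unbounded
  quantifiers are universal.\<close>

lemma row_ok_iff:
  "row_ok I r \<longleftrightarrow> (\<forall>n j t. r n < 2 \<and> (n \<in> I \<longrightarrow> (\<exists>j<width (2 * n + r 0). r (mark n j) = 1)) \<and>
     (r (mark n j) = 1 \<longrightarrow> n \<in> I \<and> j < width (2 * n + r 0) \<and> \<not> killed_at t (2 * n + r 0) j))"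
  unfolding row_ok_def killed_def by auto

lemma all_pair: "(\<forall>i n. S i n) \<longleftrightarrow> (\<forall>w. S (pfst w) (psnd w))"
  by (metis fst_conv prod_encode_inverse snd_conv)

lemma Pi01_Q_class: "Pi01 Q_class"
  unfolding Q_class_def row_ok_iff all_pair
  by (intro Pi01_all) (simp only: UNIV_I simp_thms, intro computable_intros)

lemma Pi01_P_class: "Pi01 P_class"
  unfolding P_class_def row_ok_iff row_def all_pair
  by (intro Pi01_all) (simp only: atMost_iff, intro computable_intros)

lemma Phi_eq_Some: "Phi e g = Some q \<longleftrightarrow> (\<forall>n. eval g (prog_of e) n = Some (q n))"
  by (auto simp: Phi_def fun_eq_iff) (metis option.sel, metis option.distinct(1))

section \<open>Reductions\<close>

lemma Phi_Q_to_P: "\<exists>e. \<forall>q\<in>Q_class. \<exists>x\<in>P_class. Phi e q = Some x"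
proof -
  \<comment> \<open>Row i keeps the label and truncates after coordinate i; subtracting 1 undoes the
    successor in \<open>mark\<close>.\<close>
  define X where "X q z = (if psnd z = 0 \<or> pfst (psnd z - 1) \<le> pfst z then q (psnd z) else 0)"
    for q :: "nat \<Rightarrow> nat" and z
  have "computable_functional X"
    unfolding X_def by (intro computable_intros)
  from computable_functional_index[OF this] obtain e where e: "\<And>q. Phi e q = Some (X q)"
    by (auto simp: Phi_eq_Some)
  have "X q \<in> P_class" if "q \<in> Q_class" for q
  proof -
    have q: "row_ok UNIV q" using that by (simp add: Q_class_def)
    have "row (X q) i 0 = q 0" "row (X q) i (mark n j) = (if n \<le> i then q (mark n j) else 0)"
      "row (X q) i a < 2" for i n j a
      using row_ok_less_2[OF q] by (simp_all add: row_def X_def)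
    with q show ?thesis
      by (auto simp: P_class_def row_ok_def split: if_splits)
  qed
  with e show ?thesis by blast
qed

text \<open>The search may diverge on some oracles, so the result speaks of a program index and of
  the arguments where a zero exists.\<close>

lemma search_index:
  assumes "computable_functional F" "computable_functional B"
  shows "\<exists>e. \<forall>g x. (\<exists>k. F g (pair x k) = 0) \<longrightarrow>
    eval g (prog_of e) x = Some (B g (pair x (LEAST k. F g (pair x k) = 0)))"
proof -
  obtain p where p: "\<And>g x. eval g p x = Some (F g x)"
    using assms(1) by (auto simp: computable_functional_def)
  obtain b where b: "\<And>g x. eval g b x = Some (B g x)"
    using assms(2) by (auto simp: computable_functional_def)
  obtain i where i: "\<And>g x. eval g i x = Some x"
    using computable_id by (auto simp: computable_functional_def)
  obtain e where e: "prog_of e = Comp b (Paired i (Mu p))"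
    using surj_prog_of by (metis surjD)
  have "eval g (prog_of e) x = Some (B g (pair x (LEAST k. F g (pair x k) = 0)))"
    if "\<exists>k. F g (pair x k) = 0" for g x
    using eval_Mu_total[of g p x "\<lambda>k. F g (pair x k)"] that
    by (simp add: e p b i del: eval.simps(9))
  then show ?thesis by blast
qed

lemma Phi_P_to_Q:
  assumes "k < 2"
  shows "\<exists>e. \<forall>x\<in>P_class. (\<forall>m. \<exists>i\<ge>m. row x i 0 = k) \<longrightarrow> (\<exists>q\<in>Q_class. Phi e x = Some q)"
proof -
  \<comment> \<open>\<open>F\<close> vanishes at the rows labelled k that are long enough to contain
    the coordinate of the queried mark. At argument 0 the search still runs, with bound 0, but the
    answer is the label k.\<close>
  define F :: "(nat \<Rightarrow> nat) \<Rightarrow> nat \<Rightarrow> nat" where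
    "F x z = of_bool (\<not> (pfst (pfst z - 1) \<le> psnd z \<and> row x (psnd z) 0 = k))" for x z
  define B where "B x z = (if pfst z = 0 then k else row x (psnd z) (pfst z))" for x z
  have "computable_functional F" "computable_functional B"
    unfolding F_def B_def row_def by (intro computable_intros)+
  from search_index[OF this] obtain e where e: "\<And>x z. \<exists>i. F x (pair z i) = 0 \<Longrightarrow>
      eval x (prog_of e) z = Some (B x (pair z (LEAST i. F x (pair z i) = 0)))" by blast
  have "\<exists>q\<in>Q_class. Phi e x = Some q"
    if x: "x \<in> P_class" and inf: "\<And>m. \<exists>i\<ge>m. row x i 0 = k" for x
  proof -
    define pos where "pos n = (LEAST i. n \<le> i \<and> row x i 0 = k)" for n
    have pos: "n \<le> pos n" "row x (pos n) 0 = k" for n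
      using LeastI_ex[of "\<lambda>i. n \<le> i \<and> row x i 0 = k"] inf[of n] by (auto simp: pos_def)
    have F: "F x (pair z i) = 0 \<longleftrightarrow> pfst (z - 1) \<le> i \<and> row x i 0 = k" for z i
      by (simp add: F_def)
    define q where "q z = (if z = 0 then k else row x (pos (pfst (z - 1))) z)" for z
    have "eval x (prog_of e) z = Some (q z)" for z
    proof -
      have "\<exists>i. F x (pair z i) = 0" unfolding F using pos by blast
      from e[OF this] show ?thesis unfolding F by (simp add: B_def q_def pos_def)
    qed
    then have "Phi e x = Some q" by (simp add: Phi_eq_Some)
    moreover have "row_ok UNIV q"
      unfolding row_ok_def
    proof (intro conjI allI ballI impI)
      fix z show "q z < 2"
        using assms row_ok_less_2[OF P_class_row[OF x]] by (simp add: q_def)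
    next
      fix n
      show "\<exists>j<width (2 * n + q 0). q (mark n j) = 1"
        using P_class_row[OF x, of "pos n"] pos[of n] by (auto simp: row_ok_def q_def)
    next
      fix n j assume "q (mark n j) = 1"
      then have "row x (pos n) (mark n j) = 1" by (simp add: q_def)
      from row_ok_mark[OF P_class_row[OF x] this] pos(2)[of n]
      show "n \<in> UNIV" "j < width (2 * n + q 0)" "j \<notin> killed (2 * n + q 0)"
        by (simp_all add: q_def)
    qed
    ultimately show ?thesis by (auto simp: Q_class_def)
  qed
  then show ?thesis by blast
qed

lemma Phi_P_to_Q_two:
  "\<exists>e e'. \<forall>x\<in>P_class. \<exists>q\<in>Q_class. Phi e x = Some q \<or> Phi e' x = Some q"
proof -
  obtain e where e: "\<And>x. x \<in> P_class \<Longrightarrow> (\<And>m. \<exists>i\<ge>m. row x i 0 = 0) \<Longrightarrow> \<exists>q\<in>Q_class. Phi e x = Some q"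
    using Phi_P_to_Q[of 0] by auto
  obtain e' where e': "\<And>x. x \<in> P_class \<Longrightarrow> (\<And>m. \<exists>i\<ge>m. row x i 0 = 1) \<Longrightarrow> \<exists>q\<in>Q_class. Phi e' x = Some q"
    using Phi_P_to_Q[of 1] by auto
  have "(\<forall>m. \<exists>i\<ge>m. row x i 0 = 0) \<or> (\<forall>m. \<exists>i\<ge>m. row x i 0 = 1)" if "x \<in> P_class" for x
  proof (rule ccontr)
    assume "\<not> ?thesis"
    then have "\<exists>m. \<forall>i\<ge>m. row x i 0 \<noteq> 0" "\<exists>m. \<forall>i\<ge>m. row x i 0 \<noteq> 1"
      by simp_all
    then obtain m m' where m: "\<forall>i\<ge>m. row x i 0 \<noteq> 0" and m': "\<forall>i\<ge>m'. row x i 0 \<noteq> 1"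
      by (elim exE)
    from m[rule_format, of "max m m'"] m'[rule_format, of "max m m'"] show False
      using P_class_less_2[OF that, of "pair (max m m') 0"] by (auto simp: row_def)
  qed
  then show ?thesis using e e' by (intro exI[of _ e] exI[of _ e']) blast
qed

section \<open>No learner\<close>

text \<open>Whole rows are fixed instead of initial segments: membership in \<open>P_class\<close>
  is a condition on each row separately, so all later rows may be exchanged freely.\<close>

definition agree :: "nat \<Rightarrow> (nat \<Rightarrow> nat) \<Rightarrow> (nat \<Rightarrow> nat) \<Rightarrow> bool" where
  "agree m x y \<longleftrightarrow> (\<forall>i<m. row x i = row y i)"

text \<open>A pair is at least its first component, so the entries below m lie in rows below
  m.\<close>

lemma agree_less:
  assumes "agree m x y" "n < m" shows "x n = y n"
proof -
  have "pfst n \<le> n" using le_prod_encode_1[of "pfst n" "psnd n"] by simp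
  with assms have "row x (pfst n) (psnd n) = row y (pfst n) (psnd n)"
    by (simp add: agree_def)
  then show ?thesis by (simp add: row_def)
qed

lemma agree_initseg: "agree m x y \<Longrightarrow> n \<le> m \<Longrightarrow> initseg x n = initseg y n"
  unfolding initseg_def by (auto intro: agree_less)

lemma agree_mono: "agree m x y \<Longrightarrow> n \<le> m \<Longrightarrow> agree n x y"
  by (auto simp: agree_def)

lemma agree_trans: "agree m x y \<Longrightarrow> agree m y z \<Longrightarrow> agree m x z"
  by (auto simp: agree_def)

text \<open>This is the Baire category argument, with finite sequences of rows as basic open sets.\<close>
lemma ex_locking:
  assumes conv: "\<And>x. x \<in> P_class \<Longrightarrow> \<exists>e. (\<lambda>n. \<Psi> (initseg x n)) \<longlonglongrightarrow> (e :: nat)"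
    and "P_class \<noteq> {}"
  shows "\<exists>x\<in>P_class. \<exists>m. \<forall>y\<in>P_class. agree m x y \<longrightarrow>
    (\<forall>n\<ge>m. \<Psi> (initseg y n) = \<Psi> (initseg x m))"
proof (rule ccontr)
  assume "\<not> ?thesis"
  then have no: "\<exists>y\<in>P_class. agree m x y \<and> (\<exists>n\<ge>m. \<Psi> (initseg y n) \<noteq> \<Psi> (initseg x m))"
    if "x \<in> P_class" for x m using that by blast
  obtain x0 where "x0 \<in> P_class" using assms(2) by blast
  have "\<exists>s. \<forall>t. fst (s t) \<in> P_class \<and>
     (agree (snd (s t)) (fst (s t)) (fst (s (Suc t))) \<and> snd (s t) < snd (s (Suc t)) \<and>
      (\<exists>n\<ge>snd (s t). n < snd (s (Suc t)) \<and>
         \<Psi> (initseg (fst (s (Suc t))) n) \<noteq> \<Psi> (initseg (fst (s t)) (snd (s t)))))"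
  proof (rule dependent_nat_choice, goal_cases)
    case 1
    show ?case using \<open>x0 \<in> P_class\<close> by (intro exI[of _ "(x0, 0)"]) simp
  next
    case (2 c t)
    then obtain y n where "y \<in> P_class" "agree (snd c) (fst c) y" "snd c \<le> n"
      "\<Psi> (initseg y n) \<noteq> \<Psi> (initseg (fst c) (snd c))"
      using no[of "fst c" "snd c"] by blast
    \<comment> \<open>With the bound \<open>Suc n\<close>, all later members share the initial
      segment of length n at which the guess has changed.\<close>
    then show ?case by (intro exI[of _ "(y, Suc n)"]) auto
  qed
  then obtain s where "\<forall>t. fst (s t) \<in> P_class \<and>
     (agree (snd (s t)) (fst (s t)) (fst (s (Suc t))) \<and> snd (s t) < snd (s (Suc t)) \<and>
      (\<exists>n\<ge>snd (s t). n < snd (s (Suc t)) \<and>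
         \<Psi> (initseg (fst (s (Suc t))) n) \<noteq> \<Psi> (initseg (fst (s t)) (snd (s t)))))"
    by (elim exE)
  then have s: "fst (s t) \<in> P_class" "agree (snd (s t)) (fst (s t)) (fst (s (Suc t)))"
    "snd (s t) < snd (s (Suc t))"
    "\<exists>n\<ge>snd (s t). n < snd (s (Suc t)) \<and>
         \<Psi> (initseg (fst (s (Suc t))) n) \<noteq> \<Psi> (initseg (fst (s t)) (snd (s t)))" for t
    by simp_all
  have mono: "snd (s t) \<le> snd (s t')" if "t \<le> t'" for t t'
    using less_imp_le[OF s(3)] that by (rule lift_Suc_mono_le)
  have ge: "t \<le> snd (s t)" for t
  proof (induction t)
    case (Suc t)
    then show ?case using s(3)[of t] by simp
  qed simp
  have later: "agree (snd (s t)) (fst (s t)) (fst (s t'))" if "t \<le> t'" for t t'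
    using that
  proof (induction t' rule: dec_induct)
    case (step k)
    then show ?case
      using agree_mono[OF s(2)[of k] mono[of t k]] agree_trans by blast
  qed (simp add: agree_def)
  \<comment> \<open>The bounds satisfy \<open>t \<le> snd (s t)\<close>, so row i no longer changes
    from stage \<open>Suc i\<close> on, and the limit takes it from there.\<close>
  define z where "z a = fst (s (Suc (pfst a))) a" for a
  have row_z: "row z i = row (fst (s (Suc i))) i" for i
    by (simp add: row_def z_def fun_eq_iff)
  have z_agree: "agree (snd (s t)) (fst (s t)) z" for t
    unfolding agree_def row_z
  proof (intro allI impI)
    fix i assume i: "i < snd (s t)"
    show "row (fst (s t)) i = row (fst (s (Suc i))) i"
    proof (cases "t \<le> Suc i")
      case True
      from later[OF this] i show ?thesis by (simp add: agree_def)
    next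
      case False
      with later[of "Suc i" t] ge[of "Suc i"] show ?thesis by (simp add: agree_def)
    qed
  qed
  have "z \<in> P_class"
    using P_class_row[OF s(1)] by (simp add: P_class_def row_z)
  then obtain e N where N: "\<And>n. N \<le> n \<Longrightarrow> \<Psi> (initseg z n) = e"
    using conv[of z] by (auto simp: tendsto_discrete eventually_sequentially)
  obtain n where n: "snd (s N) \<le> n" "n < snd (s (Suc N))"
    "\<Psi> (initseg (fst (s (Suc N))) n) \<noteq> \<Psi> (initseg (fst (s N)) (snd (s N)))"
    using s(4)[of N] by blast
  have "initseg (fst (s (Suc N))) n = initseg z n"
    using agree_initseg[OF z_agree] n(2) by simp
  moreover have "initseg (fst (s N)) (snd (s N)) = initseg z (snd (s N))"
    using agree_initseg[OF z_agree] by simp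
  ultimately show False
    using n N[of n] N[of "snd (s N)"] ge[of N] by simp
qed

section \<open>Continuing finitely many rows by a solution\<close>

definition splice_rows :: "nat \<Rightarrow> (nat \<Rightarrow> nat) \<Rightarrow> nat \<Rightarrow> (nat \<Rightarrow> nat) \<Rightarrow> nat \<Rightarrow> nat" where
  "splice_rows m x l f z =
     (if pfst z < m then x z else if psnd z = 0 then l
      else of_bool (pfst (psnd z - 1) \<le> pfst z \<and> f (pfst (psnd z - 1)) = psnd (psnd z - 1)))"

lemma row_splice:
  "row (splice_rows m x l f) i = (if i < m then row x i else
     (\<lambda>a. if a = 0 then l else of_bool (pfst (a - 1) \<le> i \<and> f (pfst (a - 1)) = psnd (a - 1))))"
  by (simp add: row_def splice_rows_def fun_eq_iff)

lemma splice_agree: "agree m x (splice_rows m x l f)"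
  by (simp add: agree_def row_splice)

lemma splice_P_class:
  assumes "\<And>i. i < m \<Longrightarrow> row_ok {..i} (row x i)" "f \<in> solutions l" "l < 2"
  shows "splice_rows m x l f \<in> P_class"
  unfolding P_class_def
proof (intro CollectI allI)
  fix i
  show "row_ok {..i} (row (splice_rows m x l f) i)"
  proof (cases "i < m")
    case False
    then show ?thesis
      using assms(2,3) by (auto simp: row_splice row_ok_def solutions_def)
  qed (simp add: row_splice assms(1))
qed

text \<open>The first m rows contain only finitely many ones, because marked coordinates and values
  are bounded. They are built into the program as the finite set \<open>D\<close>.\<close>

lemma computable_splice:
  assumes "x \<in> P_class"
  shows "computable_functional (splice_rows m x l)"
proof -
  define D where "D = {z. pfst z < m \<and> x z = 1}"
  have "D \<subseteq> (\<lambda>i. pair i 0) ` {..<m} \<union>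
    (\<lambda>(i, n, j). pair i (mark n j)) ` ({..<m} \<times> {..<m} \<times> {..<width (2 * m)})"
  proof
    fix z assume z: "z \<in> D"
    show "z \<in> (\<lambda>i. pair i 0) ` {..<m} \<union>
      (\<lambda>(i, n, j). pair i (mark n j)) ` ({..<m} \<times> {..<m} \<times> {..<width (2 * m)})"
    proof (cases "psnd z")
      case 0
      then have "z = pair (pfst z) 0" by (metis pair_decode)
      then show ?thesis using z by (auto simp: D_def)
    next
      case (Suc a)
      define i n j where "i = pfst z" "n = pfst a" "j = psnd a"
      have eq: "z = pair i (mark n j)"
        by (metis Suc i_n_j_def pair_decode)
      then have "row x i (mark n j) = 1" using z by (simp add: D_def row_def)
      from row_ok_mark[OF P_class_row[OF assms] this]
      have "n \<le> i" "j < width (2 * n + row x i 0)" by auto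
      moreover have i: "i < m" using z by (simp add: D_def i_n_j_def)
      moreover have "width (2 * n + row x i 0) \<le> width (2 * m)"
        using \<open>n \<le> i\<close> i row_ok_less_2[OF P_class_row[OF assms], of i 0] by (intro width_mono) linarith
      ultimately show ?thesis using eq by force
    qed
  qed
  then have "finite D" by (rule finite_subset) simp
  from decidable_finite[OF this] have D: "decidable (\<lambda>g z. z \<in> D)" .
  have "splice_rows m x l = (\<lambda>f z. if pfst z < m then of_bool (z \<in> D) else if psnd z = 0 then l
      else of_bool (pfst (psnd z - 1) \<le> pfst z \<and> f (pfst (psnd z - 1)) = psnd (psnd z - 1)))"
    using P_class_less_2[OF assms] by (auto simp: fun_eq_iff splice_rows_def D_def less_2_cases_iff)
  moreover have "computable_functional \<dots>"
    by (intro computable_intros D)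
  ultimately show ?thesis by simp
qed

lemma not_learnable:
  assumes "\<And>x. x \<in> P_class \<Longrightarrow>
    \<exists>e. (\<lambda>n. \<Psi> (initseg x n)) \<longlonglongrightarrow> e \<and> (\<exists>q\<in>Q_class. Phi e x = Some q)"
  shows False
proof -
  \<comment> \<open>For N = 1 the diagonalization supplies a solution of problem 0; spliced after no
    rows at all, it shows that \<open>P_class\<close> is nonempty.\<close>
  obtain f0 where "f0 \<in> solutions 0"
    using diagonalization[of 1] by auto
  then have "P_class \<noteq> {}"
    using splice_P_class[of 0 _ f0 0] by auto
  then obtain x m where x: "x \<in> P_class" and lock: "\<And>y n. y \<in> P_class \<Longrightarrow> agree m x y \<Longrightarrow>
      m \<le> n \<Longrightarrow> \<Psi> (initseg y n) = \<Psi> (initseg x m)"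
    using ex_locking[of \<Psi>] assms by meson
  define e where "e = \<Psi> (initseg x m)"
  have e: "\<exists>q\<in>Q_class. Phi e y = Some q" if y: "y \<in> P_class" "agree m x y" for y
  proof -
    obtain e' where e': "(\<lambda>n. \<Psi> (initseg y n)) \<longlonglongrightarrow> e'" "\<exists>q\<in>Q_class. Phi e' y = Some q"
      using assms[OF y(1)] by blast
    then obtain N where "\<And>n. N \<le> n \<Longrightarrow> \<Psi> (initseg y n) = e'"
      by (auto simp: tendsto_discrete eventually_sequentially)
    from this[of "max N m"] lock[OF y, of "max N m"] have "e' = e" by (simp add: e_def)
    with e' show ?thesis by simp
  qed
  obtain q0 where q0: "q0 \<in> Q_class" "Phi e x = Some q0"
    using e[OF x] by (auto simp: agree_def)
  define k where "k = q0 0"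
  define l where "l = 1 - k"
  have k: "k < 2" using q0(1) row_ok_less_2 by (auto simp: Q_class_def k_def)
  have "eval x (prog_of e) 0 = Some k" using q0(2) by (simp add: Phi_eq_Some k_def)
  \<comment> \<open>The label k depends on finitely many oracle entries only, so it persists when
    later rows come from a solution of the other problem l.\<close>
  from eval_use[OF this] obtain u where
    u: "\<And>h. (\<And>i. i < u \<Longrightarrow> h i = x i) \<Longrightarrow> eval h (prog_of e) 0 = Some k" by blast
  \<comment> \<open>Agreement on m rows keeps the guess at e, agreement on u rows keeps the label at
    k.\<close>
  define m' where "m' = max m u"
  have out: "\<exists>q\<in>Q_class. Phi e (splice_rows m' x l f) = Some q \<and> q 0 = k"
    if f: "f \<in> solutions l" for f
  proof -
    let ?y = "splice_rows m' x l f"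
    have y: "agree m' x ?y" by (rule splice_agree)
    moreover have "?y \<in> P_class" using P_class_row[OF x] f by (intro splice_P_class) (auto simp: l_def)
    ultimately obtain q where q: "q \<in> Q_class" "Phi e ?y = Some q"
      using e[of ?y] agree_mono[of m' x ?y m] by (auto simp: m'_def)
    have "eval ?y (prog_of e) 0 = Some k"
      using agree_less[OF y] by (intro u) (simp add: m'_def)
    with q show ?thesis by (auto simp: Phi_eq_Some)
  qed
  obtain ps where ps: "\<And>f z. eval f ps z = Some (splice_rows m' x l f z)"
    using computable_splice[OF x, of m' l] by (auto simp: computable_functional_def)
  have "computable_functional (\<lambda>g z. 1 - z)" by (intro computable_intros)
  then obtain pn where pn: "\<And>g z. eval g pn z = Some (1 - z)"
    by (auto simp: computable_functional_def)
  \<comment> \<open>The search hands over \<open>pair d j\<close> on input d, and its successor is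
    \<open>mark d j\<close>. So d returns the least value marked at coordinate d when e runs on the
    spliced sequence.\<close>
  obtain d where d: "prog_of d = Mu (Comp pn (Comp (subst_oracle ps (prog_of e)) Succ))"
    using surj_prog_of by (metis surjD)
  \<comment> \<open>This requirement attacks d at argument d, with solutions of l as oracles, and
    kills at coordinate d of problem k.\<close>
  define N where "N = 2 * d + k"
  have N: "N mod 2 = k" "N div 2 = d" using k by (auto simp: N_def)
  obtain f where f: "f \<in> solutions l"
    and kill: "\<And>v. eval f (prog_of d) d = Some v \<Longrightarrow> v < width N \<Longrightarrow> v \<in> killed N"
    using diagonalization[of N] unfolding N l_def by blast
  obtain q where q: "row_ok UNIV q" "\<And>z. eval (splice_rows m' x l f) (prog_of e) z = Some (q z)" "q 0 = k"
    using out[OF f] by (auto simp: Q_class_def Phi_eq_Some)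
  define v where "v = (LEAST j. 1 - q (mark d j) = 0)"
  have zero: "1 - q (mark d j) = 0 \<longleftrightarrow> q (mark d j) = 1" for j
    using row_ok_less_2[OF q(1), of "mark d j"] by auto
  have ex: "\<exists>j. 1 - q (mark d j) = 0"
    using row_ok_ex[OF q(1), of d] unfolding zero by simp
  have "eval f (prog_of d) d = Some v"
    unfolding d v_def using ex
    by (intro eval_Mu_total) (simp_all add: eval_subst_oracle[OF ps] q(2) pn)
  moreover have "1 - q (mark d v) = 0"
    unfolding v_def by (rule LeastI_ex[OF ex])
  then have "q (mark d v) = 1" unfolding zero .
  then have "v < width N \<and> v \<notin> killed N"
    using row_ok_mark[OF q(1)] q(3) by (simp add: N_def)
  ultimately show False using kill by blast
qed

section \<open>Constant learners and the main result\<close>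

lemma learner_const: "\<exists>d. computes d (\<lambda>_. c)"
proof -
  obtain d where "\<forall>g x. eval g (prog_of d) x = Some c"
    using computable_functional_index[OF computable_const] by blast
  then show ?thesis by (auto simp: computes_def)
qed

lemma identifies_const: "identifies (\<lambda>_. e) \<Gamma> g \<longleftrightarrow> Phi e g = \<Gamma> g"
  by (auto simp: identifies_def tendsto_discrete)

lemma computable_1_omega_Phi: "computable_1_omega (\<lambda>g. if g \<in> B then Phi e g else None)"
proof -
  have "learner (\<lambda>_. e)" using learner_const by (simp add: learner_def)
  then show ?thesis
    unfolding computable_1_omega_def by (intro exI[of _ "\<lambda>_. e"]) (auto simp: identifies_const dom_def)
qed

lemma computable_fin_1_cases:
  assumes "\<And>g. g \<in> dom \<Gamma> \<Longrightarrow> \<Gamma> g = Phi e g \<or> \<Gamma> g = Phi e' g"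
  shows "computable_fin_1 \<Gamma>"
  unfolding computable_fin_1_def
  using assms by (intro exI[of _ "Suc (max e e')"]) (metis less_Suc_eq_le max.cobounded1 max.cobounded2)

lemma computable_fin_1_imp_fin_omega:
  assumes "computable_fin_1 \<Gamma>"
  shows "computable_fin_omega \<Gamma>"
proof -
  obtain b where b: "\<And>g. g \<in> dom \<Gamma> \<Longrightarrow> \<exists>e<b. \<Gamma> g = Phi e g"
    using assms by (auto simp: computable_fin_1_def)
  obtain c where "\<And>e. computes (c e) (\<lambda>_. e)"
    using learner_const by metis
  then have c: "Psi (c e) = (\<lambda>_. e)" for e by (simp add: Psi_eqI)
  \<comment> \<open>The sum of the indices of the b constant learners bounds each of them.\<close>
  have "\<exists>d<Suc (\<Sum>e<b. c e). identifies (Psi d) \<Gamma> g" if g: "g \<in> dom \<Gamma>" for g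
  proof -
    obtain e where e: "e < b" "\<Gamma> g = Phi e g" using b[OF g] by blast
    then have "c e \<le> (\<Sum>e<b. c e)" by (intro member_le_sum) auto
    with e show ?thesis
      by (intro exI[of _ "c e"]) (simp add: c identifies_const less_Suc_eq_le)
  qed
  then show ?thesis unfolding computable_fin_omega_def by blast
qed

lemma reducible_mono:
  "reducible C A B \<Longrightarrow> (\<And>\<Gamma>. C \<Gamma> \<Longrightarrow> D \<Gamma>) \<Longrightarrow> reducible D A B"
  unfolding reducible_def by blast

theorem corollary14:
  "(\<exists>P Q. P \<subseteq> cantor_space \<and> Q \<subseteq> cantor_space \<and> Pi01 P \<and> Pi01 Q \<and>
      equivalent computable_fin_1 P Q \<and> \<not> reducible computable_1_omega Q P) \<and>
   (\<exists>P Q. P \<subseteq> cantor_space \<and> Q \<subseteq> cantor_space \<and> Pi01 P \<and> Pi01 Q \<and>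
      equivalent computable_fin_omega P Q \<and> strictly_reducible computable_1_omega P Q)"
proof -
  obtain e0 where e0: "\<And>q. q \<in> Q_class \<Longrightarrow> \<exists>x\<in>P_class. Phi e0 q = Some x"
    using Phi_Q_to_P by blast
  let ?\<Gamma>0 = "\<lambda>g. if g \<in> Q_class then Phi e0 g else None"
  have sub: "Q_class \<subseteq> dom ?\<Gamma>0 \<and> (\<forall>g\<in>Q_class. the (?\<Gamma>0 g) \<in> P_class)"
    using e0 by force
  have fin_1: "computable_fin_1 ?\<Gamma>0"
    by (rule computable_fin_1_cases[of _ e0 e0]) (auto split: if_splits)
  have PQ_1: "reducible computable_fin_1 P_class Q_class"
    unfolding reducible_def using sub fin_1 by (intro exI[of _ ?\<Gamma>0]) blast
  have PQ_omega: "reducible computable_1_omega P_class Q_class"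
    unfolding reducible_def using sub computable_1_omega_Phi by (intro exI[of _ ?\<Gamma>0]) blast
  obtain e1 e2 where e12: "\<And>x. x \<in> P_class \<Longrightarrow> \<exists>q\<in>Q_class. Phi e1 x = Some q \<or> Phi e2 x = Some q"
    using Phi_P_to_Q_two by blast
  \<comment> \<open>The choice between the two programs is not effective;
    \<open>computable_fin_1\<close> only asks that one of finitely many programs be right on each
    argument.\<close>
  define \<Gamma> where "\<Gamma> x = (if x \<in> P_class then if \<exists>q\<in>Q_class. Phi e1 x = Some q then Phi e1 x else Phi e2 x
      else None)" for x
  have \<Gamma>: "\<exists>q\<in>Q_class. \<Gamma> x = Some q" if "x \<in> P_class" for x
    using e12[OF that] that by (auto simp: \<Gamma>_def)
  have "computable_fin_1 \<Gamma>"
    by (rule computable_fin_1_cases[of _ e1 e2]) (auto simp: \<Gamma>_def split: if_splits)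
  with \<Gamma> have QP_1: "reducible computable_fin_1 Q_class P_class"
    unfolding reducible_def by (intro exI[of _ \<Gamma>]) force
  have not_QP: "\<not> reducible computable_1_omega Q_class P_class"
  proof
    assume "reducible computable_1_omega Q_class P_class"
    then obtain \<Gamma> \<Psi> where "\<And>g. g \<in> P_class \<Longrightarrow> g \<in> dom \<Gamma> \<and> the (\<Gamma> g) \<in> Q_class"
      "\<And>g. g \<in> dom \<Gamma> \<Longrightarrow> identifies \<Psi> \<Gamma> g"
      unfolding reducible_def computable_1_omega_def by blast
    then have "\<exists>e. (\<lambda>n. \<Psi> (initseg x n)) \<longlonglongrightarrow> e \<and> (\<exists>q\<in>Q_class. Phi e x = Some q)"
      if "x \<in> P_class" for x
      using that unfolding identifies_def by (metis domD option.sel)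
    then show False by (rule not_learnable)
  qed
  have "equivalent computable_fin_1 P_class Q_class"
    using PQ_1 QP_1 by (simp add: equivalent_def)
  moreover have "equivalent computable_fin_omega P_class Q_class"
    using PQ_1 QP_1 reducible_mono computable_fin_1_imp_fin_omega unfolding equivalent_def by blast
  ultimately show ?thesis
    using P_class_subset Q_class_subset Pi01_P_class Pi01_Q_class PQ_omega not_QP
    unfolding strictly_reducible_def by blast
qed

end
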